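(* (i) If $\bar p=(p(1),p(2),\dots)$ is a sequence such that $0\le p(i)<1$ for all $i$ and $$\prod_{i=1}^{\infty}(1-p(i))>0,$$ then for every first order sentence $\psi$ from $L_+$ the limit $\lim_{n\to\infty}\mathrm{Prob}(n,\bar p;\psi)$ exists. (ii) For every function $\omega(n)$ which tends to infinity as $n\to\infty$ there exist a sequence $\bar p=(p(1),p(2),\dots)$ with $0\le p(i)\le 1$ and a first order sentence $\psi$ from $L_+$ such that $$\omega(n)\prod_{i=1}^{n}(1-p(i))\to\infty\quad\text{as } n\to\infty,$$ but $\liminf_{n\to\infty}\mathrm{Prob}(n,\bar p;\psi)=0$ whereas $\limsup_{n\to\infty}\mathrm{Prob}(n,\bar p;\psi)=1$.
   Context: For a sequence $\bar p=(p(1),p(2),\dots)$ with $0\le p(i)\le 1$, $G(n,\bar p)$ is the random graph with vertex set $[n]=\{1,\dots,n\}$ in which each pair of distinct vertices $v,w$ is an edge with probability $p(|v-w|)$, independently for each pair. $L_+$ is first order logic with equality, a binary adjacency predicate, a binary successor predicate "$x=y+1$", and two individual constants. $\mathrm{Prob}(n,\bar p;\psi)$ denotes the probability that the sentence $\psi$ holds in the structure with universe $[n]$ whose adjacency relation is given by $G(n,\bar p)$, whose successor predicate is the usual successor relation on the natural numbers in $[n]$, and whose two constants are interpreted as $1$ and $n$. *)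

theory Defs
  imports "HOL-Probability.Probability"
begin

datatype lp_term = Var nat | Const_first | Const_last

text \<open>\<open>Succ s t\<close> is the atomic formula "\<open>s = t + 1\<close>". The remaining connectives and
  the universal quantifier are definable from the ones given here.\<close>

datatype lp_form =
    Eq lp_term lp_term
  | Adj lp_term lp_term
  | Succ lp_term lp_term
  | Neg lp_form
  | Conj lp_form lp_form
  | Ex nat lp_form

fun term_vars :: "lp_term \<Rightarrow> nat set" where
  "term_vars (Var x) = {x}"
| "term_vars Const_first = {}"
| "term_vars Const_last = {}"

fun free_vars :: "lp_form \<Rightarrow> nat set" where
  "free_vars (Eq s t) = term_vars s \<union> term_vars t"
| "free_vars (Adj s t) = term_vars s \<union> term_vars t"
| "free_vars (Succ s t) = term_vars s \<union> term_vars t"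
| "free_vars (Neg \<phi>) = free_vars \<phi>"
| "free_vars (Conj \<phi> \<psi>) = free_vars \<phi> \<union> free_vars \<psi>"
| "free_vars (Ex x \<phi>) = free_vars \<phi> - {x}"

definition sentence :: "lp_form \<Rightarrow> bool" where
  "sentence \<phi> \<longleftrightarrow> free_vars \<phi> = {}"

record 'a lp_struct =
  universe :: "'a set"
  adj_rel :: "'a \<Rightarrow> 'a \<Rightarrow> bool"
  succ_rel :: "'a \<Rightarrow> 'a \<Rightarrow> bool"
  first_elem :: 'a
  last_elem :: 'a

fun eval_term :: "'a lp_struct \<Rightarrow> (nat \<Rightarrow> 'a) \<Rightarrow> lp_term \<Rightarrow> 'a" where
  "eval_term M e (Var x) = e x"
| "eval_term M e Const_first = first_elem M"
| "eval_term M e Const_last = last_elem M"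

fun sat :: "'a lp_struct \<Rightarrow> (nat \<Rightarrow> 'a) \<Rightarrow> lp_form \<Rightarrow> bool" where
  "sat M e (Eq s t) \<longleftrightarrow> eval_term M e s = eval_term M e t"
| "sat M e (Adj s t) \<longleftrightarrow> adj_rel M (eval_term M e s) (eval_term M e t)"
| "sat M e (Succ s t) \<longleftrightarrow> succ_rel M (eval_term M e s) (eval_term M e t)"
| "sat M e (Neg \<phi>) \<longleftrightarrow> \<not> sat M e \<phi>"
| "sat M e (Conj \<phi> \<psi>) \<longleftrightarrow> sat M e \<phi> \<and> sat M e \<psi>"
| "sat M e (Ex x \<phi>) \<longleftrightarrow> (\<exists>a\<in>universe M. sat M (e(x := a)) \<phi>)"

text \<open>For a sentence and a nonempty universe the choice of the assignment is irrelevant.\<close>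

definition holds :: "'a lp_struct \<Rightarrow> lp_form \<Rightarrow> bool" where
  "holds M \<phi> \<longleftrightarrow> (\<forall>e. (\<forall>x. e x \<in> universe M) \<longrightarrow> sat M e \<phi>)"

text \<open>Each pair of distinct vertices is represented once, by its increasing enumeration, so that
  the coin flips are independent over unordered pairs and \<open>w - v\<close> is the distance
  \<open>\<bar>v - w\<bar>\<close>.\<close>

definition vertex_pairs :: "nat \<Rightarrow> (nat \<times> nat) set" where
  "vertex_pairs n = {(v, w). 1 \<le> v \<and> v < w \<and> w \<le> n}"

text \<open>The distribution of the edge set of the random graph; edges are two-element sets.
  The value \<open>p 0\<close> is never used.\<close>

definition random_graph :: "nat \<Rightarrow> (nat \<Rightarrow> real) \<Rightarrow> nat set set pmf" where
  "random_graph n p =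
     map_pmf (\<lambda>X. {{v, w} | v w. X (v, w)})
       (Pi_pmf (vertex_pairs n) False (\<lambda>(v, w). bernoulli_pmf (p (w - v))))"

definition graph_struct :: "nat \<Rightarrow> nat set set \<Rightarrow> nat lp_struct" where
  "graph_struct n E =
     \<lparr>universe = {1..n}, adj_rel = (\<lambda>x y. {x, y} \<in> E), succ_rel = (\<lambda>x y. x = y + 1),
      first_elem = 1, last_elem = n\<rparr>"

definition Prob :: "nat \<Rightarrow> (nat \<Rightarrow> real) \<Rightarrow> lp_form \<Rightarrow> real" where
  "Prob n p \<psi> = measure_pmf.prob (random_graph n p) {E. holds (graph_struct n E) \<psi>}"

end

theory Submission
  imports Defs
begin

text \<open>
  Part (i). Since the sum of the \<open>p i\<close> is finite, long edges are rare, and a first order sentence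
  should only notice what happens in bounded neighbourhoods. Neighbourhoods have unbounded size,
  however, so they cannot be compared up to isomorphism; they are compared by a local version
  \<open>loc_eq\<close> of the Ehrenfeucht--Fraisse game, in which every move must be close to an earlier one, at a
  distance that halves from round to round. This relation has finitely many classes for every
  number of rounds (\<open>loc_eq_finite_representatives\<close>), it is determined by a ball around
  the chosen points (\<open>loc_eq_local\<close>), and positions that are far apart can be combined
  (\<open>loc_eq_union\<close>). Consequently two graphs that agree locally around the two constants
  satisfy the same sentences of bounded quantifier rank, provided that each is rich, that is, provides
  every local type occurring in the other one away from the constants, many times and far apart
  (\<open>loc_eq_holds\<close>).

  Large random graphs are rich with high probability. A local type that occurs away from the end points
  occurs in some finite graph \<open>Y\<close> of positive probability. A translate of \<open>Y\<close> without
  any edge to the outside has the same local type at the corresponding vertex, and appears at a given place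
  with probability bounded below, because \<open>p i < 1\<close> and the infinite product is positive. Edges
  longer than some \<open>L\<close> being negligible, translates at distant places behave independently,
  so many of them appear (\<open>prob_no_planted_copy\<close>, \<open>whp_plentiful\<close>).

  The balls around the first and the last vertex stay, up to a small probability, within a bounded
  distance of the ends (\<open>nbhd_stays_near_ends\<close>). Hence the truth value of the sentence is, up to a
  small probability, a fixed function of the edges within the first \<open>L\<close> and within the last \<open>L\<close>
  vertices, whose joint distribution is the same for all large \<open>n\<close>
  (\<open>Prob_eventually_near_constant\<close>). So the probabilities form a Cauchy sequence.

  Part (ii). The sentence stating that the first and the last vertex are adjacent has probability
  \<open>p (n - 1)\<close>. If \<open>p\<close> tends to \<open>1\<close> along a sufficiently sparse sequence of places and vanishes
  elsewhere, then this probability oscillates between \<open>0\<close> and \<open>1\<close>, while the partial products tend to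
  \<open>0\<close> as slowly as desired.
\<close>

section \<open>Neighbourhoods\<close>

definition linked :: "'a lp_struct \<Rightarrow> 'a \<Rightarrow> 'a \<Rightarrow> bool" where
  "linked M x y \<longleftrightarrow> x \<in> universe M \<and> y \<in> universe M \<and>
     (adj_rel M x y \<or> adj_rel M y x \<or> succ_rel M x y \<or> succ_rel M y x)"

lemma linked_sym: "linked M x y \<longleftrightarrow> linked M y x"
  by (auto simp: linked_def)

text \<open>
  Neighbourhoods are taken in the graph that joins \<open>x\<close> and \<open>y\<close> when they are adjacent or
  consecutive, that is, in the Gaifman graph of the structure.
\<close>

fun nbhd :: "'a lp_struct \<Rightarrow> nat \<Rightarrow> 'a set \<Rightarrow> 'a set" where
  "nbhd M 0 A = A"
| "nbhd M (Suc r) A = nbhd M r A \<union> {y. \<exists>x\<in>nbhd M r A. linked M x y}"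

lemma nbhd_mono_set: "A \<subseteq> B \<Longrightarrow> nbhd M r A \<subseteq> nbhd M r B"
  by (induction r) auto

lemma nbhd_Un: "nbhd M r (A \<union> B) = nbhd M r A \<union> nbhd M r B"
  by (induction r) auto

lemma nbhd_add: "nbhd M s (nbhd M r A) = nbhd M (r + s) A"
  by (induction s) auto

lemma nbhd_mono: "r \<le> s \<Longrightarrow> nbhd M r A \<subseteq> nbhd M s A"
  by (induction s) (auto simp: le_Suc_eq)

lemma subset_nbhd: "A \<subseteq> nbhd M r A"
  using nbhd_mono[of 0 r M A] by simp

lemma nbhd_subset_universe: "A \<subseteq> universe M \<Longrightarrow> nbhd M r A \<subseteq> universe M"
  by (induction r) (auto simp: linked_def)

lemma nbhd_disjoint_sym: "nbhd M r A \<inter> B = {} \<longleftrightarrow> A \<inter> nbhd M r B = {}"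
proof (induction r arbitrary: A B)
  case (Suc r)
  have one: "nbhd M (Suc 0) A' \<inter> B' = {} \<longleftrightarrow> A' \<inter> nbhd M (Suc 0) B' = {}" for A' B'
    using linked_sym[of M] by auto
  have "nbhd M (Suc r) A = nbhd M r (nbhd M (Suc 0) A)"
    by (subst nbhd_add) simp
  moreover have "nbhd M (Suc r) B = nbhd M (Suc 0) (nbhd M r B)"
    by simp
  ultimately show ?case
    using Suc[of "nbhd M (Suc 0) A" B] one[of A "nbhd M r B"] by metis
qed auto

text \<open>
  The radii below are powers of two: a round of the local game with radius \<open>2^q\<close> may move the
  chosen points by \<open>2^q\<close>, and the neighbourhoods of radius \<open>2^q\<close> that matter afterwards must
  still lie inside those of radius \<open>2^Suc q\<close> that mattered before.
\<close>

lemma nbhd_insert_subset: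
  assumes "c \<in> nbhd M (2^q) C"
  shows "nbhd M (2^q) (insert c C) \<subseteq> nbhd M (2 ^ Suc q) C"
proof -
  have "insert c C \<subseteq> nbhd M (2^q) C" using assms subset_nbhd by fast
  then have "nbhd M (2^q) (insert c C) \<subseteq> nbhd M (2^q) (nbhd M (2^q) C)" by (rule nbhd_mono_set)
  then show ?thesis by (simp add: nbhd_add mult_2)
qed

lemma nbhd_half_subset: "nbhd M (2^q) C \<subseteq> nbhd M (2 ^ Suc q) C"
  by (rule nbhd_mono) simp

section \<open>The local back-and-forth game\<close>

definition partial_iso :: "'a lp_struct \<Rightarrow> 'b lp_struct \<Rightarrow> ('a \<times> 'b) set \<Rightarrow> bool" where
  "partial_iso M N R \<longleftrightarrow> (\<forall>a b a' b'. (a, b) \<in> R \<longrightarrow> (a', b') \<in> R \<longrightarrow>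
     (a = a' \<longleftrightarrow> b = b') \<and> (adj_rel M a a' \<longleftrightarrow> adj_rel N b b') \<and> (succ_rel M a a' \<longleftrightarrow> succ_rel N b b'))"

lemma partial_isoD:
  assumes "partial_iso M N R" "(a, b) \<in> R" "(a', b') \<in> R"
  shows "a = a' \<longleftrightarrow> b = b'" "adj_rel M a a' \<longleftrightarrow> adj_rel N b b'" "succ_rel M a a' \<longleftrightarrow> succ_rel N b b'"
  using assms(1)[unfolded partial_iso_def, rule_format, OF assms(2,3)] by auto

lemma partial_isoI:
  assumes "\<And>a b a' b'. (a, b) \<in> R \<Longrightarrow> (a', b') \<in> R \<Longrightarrow>
    (a = a' \<longleftrightarrow> b = b') \<and> (adj_rel M a a' \<longleftrightarrow> adj_rel N b b') \<and> (succ_rel M a a' \<longleftrightarrow> succ_rel N b b')"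
  shows "partial_iso M N R"
  unfolding partial_iso_def by (intro allI impI assms)

lemma partial_iso_mono:
  assumes "partial_iso M N F" "R \<subseteq> F"
  shows "partial_iso M N R"
  by (rule partial_isoI)
     (intro conjI; rule partial_isoD[OF assms(1) subsetD[OF assms(2)] subsetD[OF assms(2)]])

lemma partial_iso_converse: "partial_iso N M (R\<inverse>) \<longleftrightarrow> partial_iso M N R"
proof -
  have "partial_iso N M (R\<inverse>)" if "partial_iso M N R"
    for M :: "'c lp_struct" and N :: "'d lp_struct" and R
    by (rule partial_isoI) (simp add: partial_isoD[OF that])
  from this[of M N R] this[of N M "R\<inverse>"] show ?thesis by auto
qed

text \<open>
  The Ehrenfeucht--Fraisse game on \<open>M\<close> and \<open>N\<close>, restricted to moves close to earlier ones: with
  \<open>q + 1\<close> rounds left the next point must lie within \<open>2^q\<close> of the points chosen so far. A position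
  is the set \<open>R\<close> of pairs chosen so far, rather than a pair of tuples, so that two positions
  can be merged by taking their union. The conjunct \<open>loc_eq q M N R\<close> makes equivalence with more
  rounds imply equivalence with fewer; without it, the answer to a move within the smaller radius
  would not have to lie within that radius.
\<close>

fun loc_eq :: "nat \<Rightarrow> 'a lp_struct \<Rightarrow> 'b lp_struct \<Rightarrow> ('a \<times> 'b) set \<Rightarrow> bool" where
  "loc_eq 0 M N R = partial_iso M N R"
| "loc_eq (Suc q) M N R =
     (loc_eq q M N R \<and>
      (\<forall>a\<in>nbhd M (2^q) (fst ` R). \<exists>b\<in>nbhd N (2^q) (snd ` R). loc_eq q M N (insert (a, b) R)) \<and>
      (\<forall>b\<in>nbhd N (2^q) (snd ` R). \<exists>a\<in>nbhd M (2^q) (fst ` R). loc_eq q M N (insert (a, b) R)))"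

lemma loc_eq_mono: "loc_eq q M N R \<Longrightarrow> q' \<le> q \<Longrightarrow> loc_eq q' M N R"
  by (induction q) (auto simp: le_Suc_eq)

lemma converse_insert: "(insert (a, b) R)\<inverse> = insert (b, a) (R\<inverse>)"
  by auto

lemma fst_converse: "fst ` (R\<inverse>) = snd ` R" and snd_converse: "snd ` (R\<inverse>) = fst ` R"
  by force+

lemma loc_eq_converse: "loc_eq q N M (R\<inverse>) \<longleftrightarrow> loc_eq q M N R"
proof (induction q arbitrary: R)
  case (Suc q)
  show ?case
    unfolding loc_eq.simps fst_converse snd_converse Suc converse_insert[symmetric] by blast
qed (simp add: partial_iso_converse)

text \<open>
  Two positions that are far apart on both sides can be played independently. A move is close to
  only one of them, the answer comes from that one, and the radii are chosen so that the extended
  position is still far from the other. When no rounds are left, points at distance more than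
  \<open>1\<close> are distinct and unrelated, so the union is a partial isomorphism.
\<close>

lemma loc_eq_union:
  assumes "loc_eq q M N R" "loc_eq q M N S"
    and "R \<subseteq> universe M \<times> universe N" "S \<subseteq> universe M \<times> universe N"
    and "nbhd M (2^q) (fst ` R) \<inter> fst ` S = {}" "nbhd N (2^q) (snd ` R) \<inter> snd ` S = {}"
  shows "loc_eq q M N (R \<union> S)"
  using assms
proof (induction q arbitrary: R S)
  case 0
  have "a \<noteq> a' \<and> b \<noteq> b' \<and> \<not> linked M a a' \<and> \<not> linked N b b'" if "(a, b) \<in> R" "(a', b') \<in> S" for a b a' b'
  proof -
    have "a \<in> fst ` R" "a' \<in> fst ` S" "b \<in> snd ` R" "b' \<in> snd ` S" using that by force+
    then show ?thesis using "0.prems"(5,6) by auto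
  qed
  then have cross: "a \<noteq> a' \<and> b \<noteq> b' \<and> \<not> adj_rel M a a' \<and> \<not> adj_rel M a' a \<and> \<not> succ_rel M a a' \<and> \<not> succ_rel M a' a
      \<and> \<not> adj_rel N b b' \<and> \<not> adj_rel N b' b \<and> \<not> succ_rel N b b' \<and> \<not> succ_rel N b' b"
    if "(a, b) \<in> R" "(a', b') \<in> S" for a b a' b'
    using that "0.prems"(3,4) unfolding linked_def by blast
  have "partial_iso M N (R \<union> S)"
  proof (rule partial_isoI, goal_cases)
    case (1 a b a' b')
    then show ?case
      using "0.prems"(1,2)[unfolded loc_eq.simps] partial_isoD[of M N R a b a' b'] partial_isoD[of M N S a b a' b']
        cross[of a b a' b'] cross[of a' b' a b] by auto
  qed
  then show ?case by simp
next
  case (Suc q)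
  note R = \<open>R \<subseteq> _\<close> and S = \<open>S \<subseteq> _\<close>
  \<comment> \<open>Used with \<open>T\<close> and \<open>T'\<close> in both orders, since the move may be close to either position.\<close>
  have extend: "loc_eq q M N (insert (a, b) (T \<union> T'))"
    if T: "T \<subseteq> universe M \<times> universe N" "T' \<subseteq> universe M \<times> universe N" "loc_eq (Suc q) M N T'"
      and far: "nbhd M (2 ^ Suc q) (fst ` T) \<inter> fst ` T' = {}" "nbhd N (2 ^ Suc q) (snd ` T) \<inter> snd ` T' = {}"
      and ab: "a \<in> nbhd M (2^q) (fst ` T)" "b \<in> nbhd N (2^q) (snd ` T)" "loc_eq q M N (insert (a, b) T)"
    for a b T T'
  proof -
    have "fst ` T \<subseteq> universe M" "snd ` T \<subseteq> universe N" using T by auto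
    then have "a \<in> universe M" "b \<in> universe N" using ab nbhd_subset_universe by blast+
    then have "insert (a, b) T \<subseteq> universe M \<times> universe N" using T by auto
    moreover have "nbhd M (2^q) (fst ` insert (a, b) T) \<inter> fst ` T' = {}"
      using nbhd_insert_subset[OF ab(1)] far(1) by auto
    moreover have "nbhd N (2^q) (snd ` insert (a, b) T) \<inter> snd ` T' = {}"
      using nbhd_insert_subset[OF ab(2)] far(2) by auto
    ultimately have "loc_eq q M N (insert (a, b) T \<union> T')"
      using Suc.IH[of "insert (a, b) T" T'] T ab by simp
    then show ?thesis by simp
  qed
  have far': "nbhd M (2 ^ Suc q) (fst ` S) \<inter> fst ` R = {}" "nbhd N (2 ^ Suc q) (snd ` S) \<inter> snd ` R = {}"
    using Suc.prems(5,6) unfolding nbhd_disjoint_sym[of M _ "fst ` R"] nbhd_disjoint_sym[of N _ "snd ` R"]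
    by (simp_all only: Int_commute)
  note exR = extend[OF R S Suc.prems(2) Suc.prems(5,6)]
    and exS = extend[OF S R Suc.prems(1) far', unfolded Un_commute[of S R]]
  have low: "loc_eq q M N (R \<union> S)"
  proof (rule Suc.IH)
    show "nbhd M (2^q) (fst ` R) \<inter> fst ` S = {}"
      using Suc.prems(5) nbhd_half_subset[of M q "fst ` R"] by blast
    show "nbhd N (2^q) (snd ` R) \<inter> snd ` S = {}"
      using Suc.prems(6) nbhd_half_subset[of N q "snd ` R"] by blast
  qed (use Suc.prems R S in auto)
  have forward: "\<exists>b\<in>nbhd N (2^q) (snd ` (R \<union> S)). loc_eq q M N (insert (a, b) (R \<union> S))"
    if "a \<in> nbhd M (2^q) (fst ` (R \<union> S))" for a
    using that Suc.prems(1,2) exR[of a] exS[of a] unfolding image_Un nbhd_Un loc_eq.simps by blast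
  have backward: "\<exists>a\<in>nbhd M (2^q) (fst ` (R \<union> S)). loc_eq q M N (insert (a, b) (R \<union> S))"
    if "b \<in> nbhd N (2^q) (snd ` (R \<union> S))" for b
    using that Suc.prems(1,2) exR[of _ b] exS[of _ b] unfolding image_Un nbhd_Un loc_eq.simps by blast
  show ?case using low forward backward by simp
qed

text \<open>
  Walks of length at most \<open>r\<close> from \<open>fst ` R\<close> stay in the domain of \<open>F\<close>, so \<open>F\<close> maps them
  to walks from \<open>snd ` R\<close>.
\<close>

lemma partial_iso_nbhd:
  assumes F: "partial_iso M N F" "F \<subseteq> universe M \<times> universe N" and R: "R \<subseteq> F"
    and cov: "nbhd M r (fst ` R) \<subseteq> fst ` F" and ab: "(a, b) \<in> F" "a \<in> nbhd M r (fst ` R)"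
  shows "b \<in> nbhd N r (snd ` R)"
  using cov ab
proof (induction r arbitrary: a b)
  case 0
  then obtain b' where "(a, b') \<in> R" by force
  moreover have "b = b'" using partial_isoD(1)[OF F(1) 0(2), of a b'] R calculation by blast
  ultimately show ?case by force
next
  case (Suc r)
  show ?case
  proof (cases "a \<in> nbhd M r (fst ` R)")
    case True
    then show ?thesis using Suc.IH[of a b] Suc.prems by auto
  next
    case False
    then obtain x where x: "x \<in> nbhd M r (fst ` R)" "linked M x a" using Suc.prems by auto
    obtain y where y: "(x, y) \<in> F" using x Suc.prems by force
    have "y \<in> nbhd N r (snd ` R)" using Suc.IH[OF _ y x(1)] Suc.prems by auto
    moreover have "linked N y b"
      using x(2) partial_isoD(2,3)[OF F(1) y Suc.prems(2)] partial_isoD(2,3)[OF F(1) Suc.prems(2) y]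
        F(2) y Suc.prems(2) unfolding linked_def by blast
    ultimately show ?thesis by auto
  qed
qed

text \<open>
  The local game sees only the ball of radius \<open>2^q\<close>: Duplicator answers according to a
  partial isomorphism \<open>F\<close> that covers this ball on both sides, because the moves of all rounds
  stay within distance \<open>2^(q-1) + \<dots> + 2 + 1 < 2^q\<close> of the initial points.
\<close>

lemma loc_eq_local:
  assumes F: "partial_iso M N F" "F \<subseteq> universe M \<times> universe N" and "R \<subseteq> F"
    and "nbhd M (2^q) (fst ` R) \<subseteq> fst ` F" "nbhd N (2^q) (snd ` R) \<subseteq> snd ` F"
  shows "loc_eq q M N R"
  using assms(3-)
proof (induction q arbitrary: R)
  case 0
  then show ?case using F partial_iso_mono by simp
next
  case (Suc q)
  note half = nbhd_half_subset[of M q "fst ` R"] nbhd_half_subset[of N q "snd ` R"]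
  have low: "loc_eq q M N R" using Suc half by blast
  have ext: "loc_eq q M N (insert (a, b) R)"
    if ab: "(a, b) \<in> F" "a \<in> nbhd M (2^q) (fst ` R)" "b \<in> nbhd N (2^q) (snd ` R)" for a b
  proof (rule Suc.IH)
    show "nbhd M (2^q) (fst ` insert (a, b) R) \<subseteq> fst ` F"
      using nbhd_insert_subset[OF ab(2)] Suc.prems(2) by auto
    show "nbhd N (2^q) (snd ` insert (a, b) R) \<subseteq> snd ` F"
      using nbhd_insert_subset[OF ab(3)] Suc.prems(3) by auto
  qed (use ab Suc.prems in auto)
  have forward: "\<exists>b\<in>nbhd N (2^q) (snd ` R). loc_eq q M N (insert (a, b) R)" if a: "a \<in> nbhd M (2^q) (fst ` R)" for a
  proof -
    obtain b where "(a, b) \<in> F" using a half Suc.prems by force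
    moreover have "b \<in> nbhd N (2^q) (snd ` R)"
      using partial_iso_nbhd[OF F Suc.prems(1) _ calculation a] half Suc.prems by blast
    ultimately show ?thesis using ext a by blast
  qed
  have backward: "\<exists>a\<in>nbhd M (2^q) (fst ` R). loc_eq q M N (insert (a, b) R)" if b: "b \<in> nbhd N (2^q) (snd ` R)" for b
  proof -
    obtain a where ab: "(a, b) \<in> F" using b half Suc.prems by force
    moreover have "a \<in> nbhd M (2^q) (fst ` R)"
    proof (rule partial_iso_nbhd[of N M "F\<inverse>" "R\<inverse>" "2^q" b a, unfolded fst_converse snd_converse])
      show "nbhd N (2^q) (snd ` R) \<subseteq> snd ` F" using half Suc.prems by blast
    qed (use F Suc.prems(1) b ab in \<open>auto simp: partial_iso_converse\<close>)
    ultimately show ?thesis using ext b by blast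
  qed
  show ?case using low forward backward by simp
qed

text \<open>
  Transitivity is stated for tuples: composing two sets of pairs could produce pairs that belong to
  no common index.
\<close>

lemma loc_eq_trans_lists:
  assumes "length as = length bs" "length bs = length cs"
    and "loc_eq q M N (set (zip as bs))" "loc_eq q N K (set (zip bs cs))"
  shows "loc_eq q M K (set (zip as cs))"
  using assms
proof (induction q arbitrary: as bs cs)
  case 0
  note P = 0(3,4)[unfolded loc_eq.simps]
  have "partial_iso M K (set (zip as cs))"
  proof (rule partial_isoI, goal_cases)
    case (1 a c a' c')
    obtain i j where ij: "i < length as" "j < length as" "a = as ! i" "c = cs ! i" "a' = as ! j" "c' = cs ! j"
      using 1 by (auto simp: set_zip)
    then have "(a, bs ! i) \<in> set (zip as bs)" "(a', bs ! j) \<in> set (zip as bs)"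
      "(bs ! i, c) \<in> set (zip bs cs)" "(bs ! j, c') \<in> set (zip bs cs)"
      using 0(1,2) by (auto simp: set_zip)
    then show ?case using partial_isoD[OF P(1)] partial_isoD[OF P(2)] by metis
  qed
  then show ?case by simp
next
  case (Suc q)
  have img: "fst ` set (zip xs ys) = set xs" "snd ` set (zip xs ys) = set ys"
    if "length xs = length ys" for xs :: "'x list" and ys :: "'y list"
    using that by (metis list.set_map map_fst_zip, metis list.set_map map_snd_zip)
  have app: "insert (x, y) (set (zip xs ys)) = set (zip (xs @ [x]) (ys @ [y]))"
    if "length xs = length ys" for xs :: "'x list" and ys :: "'y list" and x y
    using that by simp
  note len = Suc.prems(1,2) trans[OF Suc.prems(1,2)]
  note eqs = Suc.prems(3,4)[unfolded loc_eq.simps img[OF len(1)] img[OF len(2)] app[OF len(1)] app[OF len(2)]]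
  have "loc_eq q M K (set (zip as cs))"
    using Suc.IH[OF len(1,2)] eqs by blast
  moreover have "\<exists>c\<in>nbhd K (2^q) (set cs). loc_eq q M K (set (zip (as @ [a]) (cs @ [c])))"
    if a: "a \<in> nbhd M (2^q) (set as)" for a
  proof -
    obtain b where b: "b \<in> nbhd N (2^q) (set bs)" "loc_eq q M N (set (zip (as @ [a]) (bs @ [b])))"
      using a eqs(1) by blast
    then obtain c where "c \<in> nbhd K (2^q) (set cs)" "loc_eq q N K (set (zip (bs @ [b]) (cs @ [c])))"
      using eqs(2) by blast
    then show ?thesis using Suc.IH[of "as @ [a]" "bs @ [b]" "cs @ [c]"] b len by auto
  qed
  moreover have "\<exists>a\<in>nbhd M (2^q) (set as). loc_eq q M K (set (zip (as @ [a]) (cs @ [c])))"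
    if c: "c \<in> nbhd K (2^q) (set cs)" for c
  proof -
    obtain b where b: "b \<in> nbhd N (2^q) (set bs)" "loc_eq q N K (set (zip (bs @ [b]) (cs @ [c])))"
      using c eqs(2) by blast
    then obtain a where "a \<in> nbhd M (2^q) (set as)" "loc_eq q M N (set (zip (as @ [a]) (bs @ [b])))"
      using eqs(1) by blast
    then show ?thesis using Suc.IH[of "as @ [a]" "bs @ [b]" "cs @ [c]"] b len by auto
  qed
  ultimately show ?case
    unfolding loc_eq.simps img[OF len(3)] app[OF len(3)] by blast
qed

text \<open>
  Types of structures are coded by numbers, so that types of every rank live in one HOL type.
\<close>

lemma finite_range_code:
  fixes g :: "'x \<Rightarrow> 'y"
  assumes "finite (range g)"
  shows "\<exists>c :: 'x \<Rightarrow> nat. finite (range c) \<and> (\<forall>x y. c x = c y \<longrightarrow> g x = g y)"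
proof -
  obtain f :: "'y \<Rightarrow> nat" where f: "inj_on f (range g)"
    using finite_imp_inj_to_nat_seg[OF assms] by blast
  have "finite (range (f \<circ> g))" unfolding image_comp[symmetric] using assms by (rule finite_imageI)
  then show ?thesis using f by (intro exI[of _ "f \<circ> g"]) (auto simp: inj_on_def)
qed

text \<open>
  The type of a tuple of rank \<open>q + 1\<close> is its type of rank \<open>q\<close> together with the set of rank
  \<open>q\<close> types of its extensions by a nearby point. There are thus finitely many, although the
  neighbourhoods themselves have unbounded size.
\<close>

lemma loc_eq_finite_index:
  "\<exists>c :: 'a lp_struct \<times> 'a list \<Rightarrow> nat. finite (range c) \<and>
     (\<forall>M N as bs. length as = m \<and> length bs = m \<and> c (M, as) = c (N, bs) \<longrightarrow> loc_eq q M N (set (zip as bs)))"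
proof (induction q arbitrary: m)
  case 0
  define g :: "'a lp_struct \<times> 'a list \<Rightarrow> (nat \<times> nat \<times> bool \<times> bool \<times> bool) set" where
    "g = (\<lambda>(M, as). (\<lambda>(i, j). (i, j, as ! i = as ! j, adj_rel M (as ! i) (as ! j), succ_rel M (as ! i) (as ! j)))
            ` ({..<m} \<times> {..<m}))"
  have "range g \<subseteq> Pow ({..<m} \<times> {..<m} \<times> UNIV)" by (auto simp: g_def)
  then have "finite (range g)" by (rule finite_subset) auto
  then obtain c :: "'a lp_struct \<times> 'a list \<Rightarrow> nat"
    where c: "finite (range c)" "\<And>x y. c x = c y \<Longrightarrow> g x = g y"
    using finite_range_code by metis
  have "partial_iso M N (set (zip as bs))" 
    if len: "length as = m" "length bs = m" and eq: "c (M, as) = c (N, bs)" for M N as bs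
  proof -
    have "(i, j, as ! i = as ! j, adj_rel M (as ! i) (as ! j), succ_rel M (as ! i) (as ! j)) \<in> g (M, as)"
      if "i < m" "j < m" for i j using that by (force simp: g_def)
    then have mem: "(i, j, as ! i = as ! j, adj_rel M (as ! i) (as ! j), succ_rel M (as ! i) (as ! j)) \<in> g (N, bs)"
      if "i < m" "j < m" for i j using that c(2)[OF eq] by simp
    have same: "(as ! i = as ! j \<longleftrightarrow> bs ! i = bs ! j) \<and> (adj_rel M (as ! i) (as ! j) \<longleftrightarrow> adj_rel N (bs ! i) (bs ! j))
        \<and> (succ_rel M (as ! i) (as ! j) \<longleftrightarrow> succ_rel N (bs ! i) (bs ! j))"
      if "i < m" "j < m" for i j using mem[OF that] by (auto simp: g_def)
    show ?thesis
    proof (rule partial_isoI, goal_cases)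
      case (1 a b a' b')
      then obtain i j where "i < m" "j < m" "a = as ! i" "b = bs ! i" "a' = as ! j" "b' = bs ! j"
        using len by (auto simp: set_zip)
      then show ?case using same by blast
    qed
  qed
  then show ?case using c(1) by (auto intro!: exI[of _ c])
next
  case (Suc q)
  obtain c0 :: "'a lp_struct \<times> 'a list \<Rightarrow> nat" where c0: "finite (range c0)"
    "\<And>M N as bs. length as = m \<Longrightarrow> length bs = m \<Longrightarrow> c0 (M, as) = c0 (N, bs) \<Longrightarrow> loc_eq q M N (set (zip as bs))"
    using Suc[of m] by blast
  obtain c1 :: "'a lp_struct \<times> 'a list \<Rightarrow> nat" where c1: "finite (range c1)"
    "\<And>M N as bs. length as = Suc m \<Longrightarrow> length bs = Suc m \<Longrightarrow> c1 (M, as) = c1 (N, bs) \<Longrightarrow> loc_eq q M N (set (zip as bs))"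
    using Suc[of "Suc m"] by blast
  define g where "g = (\<lambda>(M, as). (c0 (M, as), (\<lambda>a. c1 (M, as @ [a])) ` nbhd M (2^q) (set as)))"
  have "range g \<subseteq> range c0 \<times> Pow (range c1)" by (auto simp: g_def)
  then have "finite (range g)" by (rule finite_subset) (use c0 c1 in auto)
  then obtain c :: "'a lp_struct \<times> 'a list \<Rightarrow> nat"
    where c: "finite (range c)" "\<And>x y. c x = c y \<Longrightarrow> g x = g y"
    using finite_range_code by metis
  have "loc_eq (Suc q) M N (set (zip as bs))"
    if len: "length as = m" "length bs = m" and eq: "c (M, as) = c (N, bs)" for M N as bs
  proof -
    have g: "c0 (M, as) = c0 (N, bs)"
      "(\<lambda>a. c1 (M, as @ [a])) ` nbhd M (2^q) (set as) = (\<lambda>b. c1 (N, bs @ [b])) ` nbhd N (2^q) (set bs)"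
      using c(2)[OF eq] by (auto simp: g_def)
    have img: "fst ` set (zip as bs) = set as" "snd ` set (zip as bs) = set bs"
      using len by (metis list.set_map map_fst_zip, metis list.set_map map_snd_zip)
    have ext: "loc_eq q M N (insert (a, b) (set (zip as bs)))" if "c1 (M, as @ [a]) = c1 (N, bs @ [b])" for a b
      using c1(2)[OF _ _ that] len by simp
    have "\<exists>b\<in>nbhd N (2^q) (set bs). c1 (M, as @ [a]) = c1 (N, bs @ [b])" if "a \<in> nbhd M (2^q) (set as)" for a
      using g(2) that by blast
    moreover have "\<exists>a\<in>nbhd M (2^q) (set as). c1 (M, as @ [a]) = c1 (N, bs @ [b])" if "b \<in> nbhd N (2^q) (set bs)" for b
      using g(2) that by (smt (verit) image_iff)
    ultimately show ?thesis
      unfolding loc_eq.simps img using c0(2)[OF len g(1)] ext by blast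
  qed
  then show ?case using c(1) by blast
qed

lemma loc_eq_finite_representatives:
  fixes T :: "('a lp_struct \<times> 'a) set"
  shows "\<exists>W\<subseteq>T. finite W \<and> (\<forall>(M, a)\<in>T. \<exists>(N, b)\<in>W. loc_eq q M N {(a, b)})"
proof -
  obtain c :: "'a lp_struct \<times> 'a list \<Rightarrow> nat" where c: "finite (range c)"
    "\<And>M N as bs. length as = 1 \<Longrightarrow> length bs = 1 \<Longrightarrow> c (M, as) = c (N, bs) \<Longrightarrow> loc_eq q M N (set (zip as bs))"
    using loc_eq_finite_index[of 1 q] by blast
  define d where "d = (\<lambda>(M, a). c (M, [a]))"
  have "finite (d ` T)" by (rule finite_subset[OF _ c(1)]) (auto simp: d_def)
  then obtain W where W: "W \<subseteq> T" "finite W" "d ` T = d ` W"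
    using finite_subset_image[of "d ` T" d T] by auto
  have "\<exists>(N, b)\<in>W. loc_eq q M N {(a, b)}" if Ma: "(M, a) \<in> T" for M a
  proof -
    obtain N b where "(N, b) \<in> W" "c (M, [a]) = c (N, [b])"
      using Ma W(3) by (force simp: d_def)
    then show ?thesis using c(2)[of "[a]" "[b]" M N] by auto
  qed
  then show ?thesis using W by blast
qed

lemma loc_eq_point_trans:
  assumes "loc_eq q M N {(a, b)}" "loc_eq q N K {(b, c)}"
  shows "loc_eq q M K {(a, c)}"
  using loc_eq_trans_lists[of "[a]" "[b]" "[c]"] assms by simp

section \<open>From local to global equivalence\<close>

text \<open>
  This supplies Duplicator's answers to moves far from all earlier points; \<open>B\<close> stands for the points
  of \<open>N\<close> chosen so far, the two constants among them.
\<close>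

definition rich :: "nat \<Rightarrow> nat \<Rightarrow> 'a lp_struct \<Rightarrow> 'b lp_struct \<Rightarrow> bool" where
  "rich Q K M N \<longleftrightarrow> (\<forall>q<Q. \<forall>a\<in>universe M. nbhd M (2^q) {first_elem M, last_elem M} \<inter> {a} = {} \<longrightarrow>
     (\<forall>B. finite B \<and> card B \<le> K \<longrightarrow>
       (\<exists>b\<in>universe N. nbhd N (2^q) {b} \<inter> B = {} \<and> loc_eq q M N {(a, b)})))"

text \<open>
  A move near the current position is answered in the local game; a move \<open>a\<close> far from it, and hence
  far from the constants, is answered by a far point \<open>b\<close> of the same local type, and the
  positions \<open>R\<close> and \<open>{(a, b)}\<close> are merged by \<open>loc_eq_union\<close>.
\<close>

lemma rich_extension:
  assumes rich: "rich Q K M N" and eq: "loc_eq (Suc q) M N R" and q: "q < Q"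
    and R: "R \<subseteq> universe M \<times> universe N" "finite R" "card R \<le> K"
    and const: "(first_elem M, first_elem N) \<in> R" "(last_elem M, last_elem N) \<in> R"
    and a: "a \<in> universe M"
  shows "\<exists>b\<in>universe N. loc_eq q M N (insert (a, b) R)"
proof (cases "a \<in> nbhd M (2^q) (fst ` R)")
  case True
  then obtain b where b: "b \<in> nbhd N (2^q) (snd ` R)" "loc_eq q M N (insert (a, b) R)"
    using eq by auto
  moreover have "snd ` R \<subseteq> universe N" using R by auto
  ultimately show ?thesis using nbhd_subset_universe by blast
next
  case False
  have "{first_elem M, last_elem M} \<subseteq> fst ` R" using const by force
  then have "nbhd M (2^q) {first_elem M, last_elem M} \<inter> {a} = {}"
    using False nbhd_mono_set by blast
  moreover have "finite (snd ` R)" "card (snd ` R) \<le> K"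
    using R card_image_le[of R snd] by auto
  ultimately obtain b where b: "b \<in> universe N" "nbhd N (2^q) {b} \<inter> snd ` R = {}" "loc_eq q M N {(a, b)}"
    using rich q a unfolding rich_def by blast
  have "loc_eq q M N ({(a, b)} \<union> R)"
  proof (rule loc_eq_union)
    show "nbhd M (2^q) (fst ` {(a, b)}) \<inter> fst ` R = {}"
      using False nbhd_disjoint_sym[of M "2^q" "{a}" "fst ` R"] by auto
  qed (use b eq a R in auto)
  then show ?thesis using b(1) by auto
qed

fun qrank :: "lp_form \<Rightarrow> nat" where
  "qrank (Eq s t) = 0"
| "qrank (Adj s t) = 0"
| "qrank (Succ s t) = 0"
| "qrank (Neg \<phi>) = qrank \<phi>"
| "qrank (Conj \<phi> \<psi>) = max (qrank \<phi>) (qrank \<psi>)"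
| "qrank (Ex x \<phi>) = Suc (qrank \<phi>)"

lemma loc_eq_partial_iso: "loc_eq q M N R \<Longrightarrow> partial_iso M N R"
  using loc_eq_mono[of q M N R 0] by simp

lemma eval_term_related:
  assumes "(first_elem M, first_elem N) \<in> R" "(last_elem M, last_elem N) \<in> R" "\<And>x. (e x, e' x) \<in> R"
  shows "(eval_term M e t, eval_term N e' t) \<in> R"
  using assms by (cases t) auto

lemma eval_term_cong:
  assumes "\<And>x. x \<in> term_vars t \<Longrightarrow> e x = e' x"
  shows "eval_term M e t = eval_term M e' t"
  using assms by (cases t) auto

lemma loc_eq_sat:
  assumes rich: "rich Q K M N" "rich Q K N M"
    and "loc_eq q M N R" "qrank \<phi> \<le> q" "q \<le> Q"
    and "R \<subseteq> universe M \<times> universe N" "finite R" "card R + q \<le> Suc K"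
    and "(first_elem M, first_elem N) \<in> R" "(last_elem M, last_elem N) \<in> R"
    and "\<And>x. (e x, e' x) \<in> R"
  shows "sat M e \<phi> \<longleftrightarrow> sat N e' \<phi>"
  using assms(3-)
proof (induction \<phi> arbitrary: q R e e')
  case (Eq s t)
  have "(eval_term M e u, eval_term N e' u) \<in> R" for u
    by (rule eval_term_related[OF Eq(7,8,9)])
  from partial_isoD[OF loc_eq_partial_iso[OF Eq(1)] this[of s] this[of t]]
  show ?case by simp
next
  case (Adj s t)
  have "(eval_term M e u, eval_term N e' u) \<in> R" for u
    by (rule eval_term_related[OF Adj(7,8,9)])
  from partial_isoD[OF loc_eq_partial_iso[OF Adj(1)] this[of s] this[of t]]
  show ?case by simp
next
  case (Succ s t)
  have "(eval_term M e u, eval_term N e' u) \<in> R" for u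
    by (rule eval_term_related[OF Succ(7,8,9)])
  from partial_isoD[OF loc_eq_partial_iso[OF Succ(1)] this[of s] this[of t]]
  show ?case by simp
next
  case (Neg \<phi>)
  have "sat M e \<phi> \<longleftrightarrow> sat N e' \<phi>"
    by (rule Neg.IH[OF Neg.prems(1) _ Neg.prems(3-9)]) (use Neg.prems(2) in simp)
  then show ?case by simp
next
  case (Conj \<phi>1 \<phi>2)
  have "sat M e \<phi>1 \<longleftrightarrow> sat N e' \<phi>1"
    by (rule Conj.IH(1)[OF Conj.prems(1) _ Conj.prems(3-9)]) (use Conj.prems(2) in simp)
  moreover have "sat M e \<phi>2 \<longleftrightarrow> sat N e' \<phi>2"
    by (rule Conj.IH(2)[OF Conj.prems(1) _ Conj.prems(3-9)]) (use Conj.prems(2) in simp)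
  ultimately show ?case by simp
next
  case (Ex x \<phi>)
  from Ex.prems(2) obtain q' where q: "q = Suc q'" by (cases q) auto
  have step: "sat M (e(x := a)) \<phi> \<longleftrightarrow> sat N (e'(x := b)) \<phi>"
    if ab: "a \<in> universe M" "b \<in> universe N" "loc_eq q' M N (insert (a, b) R)" for a b
  proof (rule Ex.IH[OF ab(3)])
    show "qrank \<phi> \<le> q'" "q' \<le> Q" using Ex.prems(2,3) q by simp_all
    show "insert (a, b) R \<subseteq> universe M \<times> universe N" "finite (insert (a, b) R)"
      using Ex.prems(4,5) ab by simp_all
    show "card (insert (a, b) R) + q' \<le> Suc K"
      using Ex.prems(5,6) q by (simp add: card_insert_if)
    show "(first_elem M, first_elem N) \<in> insert (a, b) R" "(last_elem M, last_elem N) \<in> insert (a, b) R"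
      using Ex.prems(7,8) by simp_all
    show "((e(x := a)) y, (e'(x := b)) y) \<in> insert (a, b) R" for y
      using Ex.prems(9)[of y] by simp
  qed
  have le: "q' < Q" "card R \<le> K" using q Ex.prems(3,6) by simp_all
  have eq: "loc_eq (Suc q') M N R" using Ex.prems(1) unfolding q .
  have "\<exists>b\<in>universe N. loc_eq q' M N (insert (a, b) R)" if "a \<in> universe M" for a
    by (rule rich_extension[OF rich(1) eq le(1) Ex.prems(4,5) le(2) Ex.prems(7,8) that])
  moreover have "\<exists>a\<in>universe M. loc_eq q' M N (insert (a, b) R)" if "b \<in> universe N" for b
  proof -
    have "\<exists>a\<in>universe M. loc_eq q' N M (insert (b, a) (R\<inverse>))"
    proof (rule rich_extension[OF rich(2) _ le(1)])
      show "loc_eq (Suc q') N M (R\<inverse>)" using eq by (simp only: loc_eq_converse)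
      show "R\<inverse> \<subseteq> universe N \<times> universe M" using Ex.prems(4) by blast
      show "finite (R\<inverse>)" "card (R\<inverse>) \<le> K" using Ex.prems(5) le by simp_all
      show "(first_elem N, first_elem M) \<in> R\<inverse>" "(last_elem N, last_elem M) \<in> R\<inverse>"
        using Ex.prems(7,8) by simp_all
    qed (rule that)
    then show ?thesis unfolding converse_insert[symmetric] loc_eq_converse .
  qed
  ultimately show ?case using step unfolding sat.simps by metis
qed

lemma sat_cong:
  "(\<And>x. x \<in> free_vars \<phi> \<Longrightarrow> e x = e' x) \<Longrightarrow> sat M e \<phi> \<longleftrightarrow> sat M e' \<phi>"
proof (induction \<phi> arbitrary: e e')
  case (Eq s t)
  have "eval_term M e s = eval_term M e' s"
    by (rule eval_term_cong) (use Eq in simp)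
  moreover have "eval_term M e t = eval_term M e' t"
    by (rule eval_term_cong) (use Eq in simp)
  ultimately show ?case by simp
next
  case (Adj s t)
  have "eval_term M e s = eval_term M e' s"
    by (rule eval_term_cong) (use Adj in simp)
  moreover have "eval_term M e t = eval_term M e' t"
    by (rule eval_term_cong) (use Adj in simp)
  ultimately show ?case by simp
next
  case (Succ s t)
  have "eval_term M e s = eval_term M e' s"
    by (rule eval_term_cong) (use Succ in simp)
  moreover have "eval_term M e t = eval_term M e' t"
    by (rule eval_term_cong) (use Succ in simp)
  ultimately show ?case by simp
next
  case (Neg \<phi>)
  have "sat M e \<phi> \<longleftrightarrow> sat M e' \<phi>"
    by (rule Neg.IH) (use Neg.prems in simp)
  then show ?case by simp
next
  case (Conj \<phi>1 \<phi>2)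
  have "sat M e \<phi>1 \<longleftrightarrow> sat M e' \<phi>1"
    by (rule Conj.IH(1)) (use Conj.prems in simp)
  moreover have "sat M e \<phi>2 \<longleftrightarrow> sat M e' \<phi>2"
    by (rule Conj.IH(2)) (use Conj.prems in simp)
  ultimately show ?case by simp
next
  case (Ex x \<phi>)
  have "sat M (e(x := a)) \<phi> \<longleftrightarrow> sat M (e'(x := a)) \<phi>" for a
    by (rule Ex.IH) (use Ex.prems in simp)
  then show ?case by simp
qed

lemma holds_sentence:
  assumes "sentence \<phi>" "a \<in> universe M"
  shows "holds M \<phi> \<longleftrightarrow> sat M (\<lambda>_. a) \<phi>"
  using assms sat_cong[of \<phi> _ "\<lambda>_. a" M] unfolding holds_def sentence_def by auto

text \<open>
  The starting position consists of the two constants; the bound \<open>Suc Q\<close> is the number of points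
  that have been chosen before the last of \<open>Q\<close> rounds.
\<close>

lemma loc_eq_holds:
  assumes "rich Q (Suc Q) M N" "rich Q (Suc Q) N M" "sentence \<psi>" "qrank \<psi> \<le> Q"
    and "loc_eq Q M N {(first_elem M, first_elem N), (last_elem M, last_elem N)}"
    and "first_elem M \<in> universe M" "last_elem M \<in> universe M" "first_elem N \<in> universe N" "last_elem N \<in> universe N"
  shows "holds M \<psi> \<longleftrightarrow> holds N \<psi>"
proof -
  have "sat M (\<lambda>_. first_elem M) \<psi> \<longleftrightarrow> sat N (\<lambda>_. first_elem N) \<psi>"
    by (rule loc_eq_sat[OF assms(1,2,5,4)]) (use assms in \<open>auto simp: card_insert_if\<close>)
  then show ?thesis using assms by (simp add: holds_sentence)
qed

section \<open>Independent coordinates of a product distribution\<close>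

lemma prob_mono_support:
  assumes "\<And>x. x \<in> set_pmf M \<Longrightarrow> x \<in> A \<Longrightarrow> x \<in> B"
  shows "measure_pmf.prob M A \<le> measure_pmf.prob M B"
proof -
  have "measure_pmf.prob M A = measure_pmf.prob M (A \<inter> set_pmf M)"
    by (simp add: measure_Int_set_pmf)
  also have "\<dots> \<le> measure_pmf.prob M B"
    by (rule measure_pmf.finite_measure_mono) (use assms in auto)
  finally show ?thesis .
qed

lemma prob_Un_le:
  "measure_pmf.prob M (A \<union> B) \<le> measure_pmf.prob M A + measure_pmf.prob M B"
  by (rule measure_Un_le) auto

lemma prob_pair_pmf_times:
  "measure_pmf.prob (pair_pmf M N) (A \<times> B) = measure_pmf.prob M A * measure_pmf.prob N B"
proof -
  have "measure_pmf.prob (pair_pmf M N) (A \<times> B)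
      = measure_pmf.prob (pair_pmf M N) ((A \<inter> set_pmf M) \<times> (B \<inter> set_pmf N))"
    using measure_Int_set_pmf[of "pair_pmf M N" "A \<times> B"] by (simp add: Times_Int_Times)
  also have "\<dots> = measure_pmf.prob M A * measure_pmf.prob N B"
    by (subst measure_pmf_prob_product) (auto simp: measure_Int_set_pmf)
  finally show ?thesis .
qed

lemma prob_Pi_pmf_indep:
  assumes A: "finite A" "Q \<subseteq> A"
    and E: "\<And>X Y. (\<And>x. x \<in> Q \<Longrightarrow> X x = Y x) \<Longrightarrow> X \<in> E \<Longrightarrow> Y \<in> E"
    and F: "\<And>X Y. (\<And>x. x \<in> A - Q \<Longrightarrow> X x = Y x) \<Longrightarrow> X \<in> F \<Longrightarrow> Y \<in> F"
  shows "measure_pmf.prob (Pi_pmf A d D) (E \<inter> F)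
       = measure_pmf.prob (Pi_pmf A d D) E * measure_pmf.prob (Pi_pmf A d D) F"
proof -
  define h :: "('a \<Rightarrow> 'b) \<times> ('a \<Rightarrow> 'b) \<Rightarrow> 'a \<Rightarrow> 'b"
    where "h = (\<lambda>(f, g) x. if x \<in> Q then f x else g x)"
  let ?M = "Pi_pmf Q d D" and ?N = "Pi_pmf (A - Q) d D"
  have Q: "finite Q" "finite (A - Q)" "Q \<inter> (A - Q) = {}" "Q \<union> (A - Q) = A" using A finite_subset by auto
  have split: "Pi_pmf A d D = map_pmf h (pair_pmf ?M ?N)"
    using Pi_pmf_union[OF Q(1-3), of d D] unfolding Q(4) h_def .
  have hE: "h (f, g) \<in> E \<longleftrightarrow> f \<in> E" for f g
    using E[of "h (f, g)" f] E[of f "h (f, g)"] by (auto simp: h_def)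
  have hF: "h (f, g) \<in> F \<longleftrightarrow> g \<in> F" for f g
    using F[of "h (f, g)" g] F[of g "h (f, g)"] by (auto simp: h_def)
  have "h -` (E \<inter> F) = E \<times> F" "h -` E = E \<times> UNIV" "h -` F = UNIV \<times> F"
    using hE hF by auto
  then show ?thesis unfolding split measure_map_pmf by (simp add: prob_pair_pmf_times)
qed

text \<open>
  Events that depend on disjoint sets of coordinates are independent, so all of \<open>m\<close> events of
  probability at least \<open>\<delta>\<close> fail together with probability at most \<open>(1 - \<delta>)^m\<close>.
\<close>

lemma prob_Pi_pmf_none:
  assumes A: "finite A" and Q: "\<And>j. j < m \<Longrightarrow> Q j \<subseteq> A"
    and disj: "\<And>i j. i < j \<Longrightarrow> j < m \<Longrightarrow> Q i \<inter> Q j = {}"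
    and E: "\<And>j X Y. j < m \<Longrightarrow> (\<And>x. x \<in> Q j \<Longrightarrow> X x = Y x) \<Longrightarrow> X \<in> E j \<Longrightarrow> Y \<in> E j"
    and \<delta>: "\<And>j. j < m \<Longrightarrow> \<delta> \<le> measure_pmf.prob (Pi_pmf A d D) (E j)"
  shows "measure_pmf.prob (Pi_pmf A d D) {X. \<forall>j<m. X \<notin> E j} \<le> (1 - \<delta>) ^ m"
  using assms(2-)
proof (induction m)
  case (Suc m)
  let ?P = "measure_pmf.prob (Pi_pmf A d D)"
  have "?P {X. \<forall>j<Suc m. X \<notin> E j} = ?P (- E m \<inter> {X. \<forall>j<m. X \<notin> E j})"
    by (rule arg_cong[of _ _ ?P]) (auto simp: less_Suc_eq)
  also have "\<dots> = ?P (- E m) * ?P {X. \<forall>j<m. X \<notin> E j}"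
  proof (rule prob_Pi_pmf_indep[OF A Suc.prems(1)[OF lessI]])
    show "Y \<in> - E m" if "\<And>x. x \<in> Q m \<Longrightarrow> X x = Y x" "X \<in> - E m" for X Y
      using Suc.prems(3)[of m Y X] that by auto
    show "Y \<in> {X. \<forall>j<m. X \<notin> E j}" if eq: "\<And>x. x \<in> A - Q m \<Longrightarrow> X x = Y x" and X: "X \<in> {X. \<forall>j<m. X \<notin> E j}" for X Y
    proof -
      have "Y \<notin> E j" if j: "j < m" for j
      proof
        assume "Y \<in> E j"
        have "Y x = X x" if "x \<in> Q j" for x
        proof -
          have "x \<in> A" using Suc.prems(1)[of j] j that by auto
          moreover have "x \<notin> Q m" using Suc.prems(2)[of j m] j that by auto
          ultimately show ?thesis using eq by simp
        qed
        then have "X \<in> E j" using Suc.prems(3)[of j Y X] j \<open>Y \<in> E j\<close> by auto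
        then show False using X j by auto
      qed
      then show ?thesis by auto
    qed
  qed
  also have "?P (- E m) = 1 - ?P (E m)"
    using measure_pmf.prob_compl[of "E m" "Pi_pmf A d D"] by (simp add: Compl_eq_Diff_UNIV)
  also have "(1 - ?P (E m)) * ?P {X. \<forall>j<m. X \<notin> E j} \<le> (1 - \<delta>) * (1 - \<delta>) ^ m"
  proof (rule mult_mono)
    have "\<delta> \<le> ?P (E m)" "?P (E m) \<le> 1"
      using Suc.prems(4)[OF lessI] measure_pmf.prob_le_1 by blast+
    then show "1 - ?P (E m) \<le> 1 - \<delta>" "0 \<le> 1 - \<delta>" by linarith+
    show "?P {X. \<forall>j<m. X \<notin> E j} \<le> (1 - \<delta>) ^ m"
    proof (rule Suc.IH)
      show "Y \<in> E j" if "j < m" "\<And>x. x \<in> Q j \<Longrightarrow> X x = Y x" "X \<in> E j" for j X Y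
        using Suc.prems(3)[OF less_SucI[OF that(1)] that(2,3)] .
    qed (use Suc.prems(1,2,4) in auto)
  qed auto
  finally show ?case by simp
qed simp

lemma prob_Pi_pmf_cylinder:
  assumes "finite A" "Q \<subseteq> A"
  shows "measure_pmf.prob (Pi_pmf A d D) {X. \<forall>x\<in>Q. X x = f x} = (\<Prod>x\<in>Q. pmf (D x) (f x))"
proof -
  have "{X. \<forall>x\<in>Q. X x = f x} = Pi A (\<lambda>x. if x \<in> Q then {f x} else UNIV)"
    using assms(2) by (auto simp: Pi_def split: if_splits)
  then have "measure_pmf.prob (Pi_pmf A d D) {X. \<forall>x\<in>Q. X x = f x}
      = (\<Prod>x\<in>A. if x \<in> Q then pmf (D x) (f x) else 1)"
    by (simp only: measure_Pi_pmf_Pi[OF assms(1)]) (rule prod.cong, auto simp: measure_pmf_single)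
  also have "\<dots> = (\<Prod>x\<in>Q. pmf (D x) (f x))"
    using assms by (simp add: prod.If_cases Int_absorb1)
  finally show ?thesis .
qed

lemma Pi_pmf_reindex:
  assumes A: "finite A" and h: "inj_on h I" "h ` I \<subseteq> A"
  shows "map_pmf (\<lambda>X i. if i \<in> I then X (h i) else d) (Pi_pmf A d D) = Pi_pmf I d (\<lambda>i. D (h i))"
proof (rule pmf_eqI)
  fix f
  have I: "finite I" using A h finite_imageD finite_subset by metis
  let ?r = "\<lambda>X i. if i \<in> I then X (h i) else d"
  show "pmf (map_pmf ?r (Pi_pmf A d D)) f = pmf (Pi_pmf I d (\<lambda>i. D (h i))) f"
  proof (cases "\<forall>i. i \<notin> I \<longrightarrow> f i = d")
    case True
    have "?r -` {f} = {X. \<forall>x\<in>h ` I. X x = f (the_inv_into I h x)}"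
      using True h(1) by (auto simp: the_inv_into_f_f fun_eq_iff)
    then have "pmf (map_pmf ?r (Pi_pmf A d D)) f = (\<Prod>x\<in>h ` I. pmf (D x) (f (the_inv_into I h x)))"
      using prob_Pi_pmf_cylinder[OF A h(2)] by (simp add: pmf_map)
    also have "\<dots> = (\<Prod>i\<in>I. pmf (D (h i)) (f i))"
      using h(1) by (simp add: prod.reindex the_inv_into_f_f)
    finally show ?thesis using True by (simp add: pmf_Pi'[OF I])
  next
    case False
    then have "?r -` {f} = {}" by (auto simp: fun_eq_iff)
    then show ?thesis using False by (simp add: pmf_map pmf_Pi_outside[OF I])
  qed
qed

section \<open>Edge probabilities with convergent sum\<close>

definition edge_pmf :: "nat \<Rightarrow> (nat \<Rightarrow> real) \<Rightarrow> (nat \<times> nat \<Rightarrow> bool) pmf" where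
  "edge_pmf n p = Pi_pmf (vertex_pairs n) False (\<lambda>(v, w). bernoulli_pmf (p (w - v)))"

definition pair_graph :: "nat \<Rightarrow> (nat \<times> nat \<Rightarrow> bool) \<Rightarrow> nat lp_struct" where
  "pair_graph n X = graph_struct n {{v, w} | v w. X (v, w)}"

definition joined :: "(nat \<times> nat \<Rightarrow> bool) \<Rightarrow> nat \<Rightarrow> nat \<Rightarrow> bool" where
  "joined X v w \<longleftrightarrow> X (v, w) \<or> X (w, v)"

lemma pair_graph_simps [simp]:
  "universe (pair_graph n X) = {1..n}"
  "adj_rel (pair_graph n X) = joined X"
  "succ_rel (pair_graph n X) x y \<longleftrightarrow> x = y + 1"
  "first_elem (pair_graph n X) = 1"
  "last_elem (pair_graph n X) = n"
proof -
  have "{x, y} \<in> {{v, w} | v w. X (v, w)} \<longleftrightarrow> joined X x y" for x y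
    unfolding joined_def mem_Collect_eq doubleton_eq_iff by metis
  then show "adj_rel (pair_graph n X) = joined X"
    by (simp add: pair_graph_def graph_struct_def)
qed (simp_all add: pair_graph_def graph_struct_def)

lemma Prob_eq_edge_pmf:
  "Prob n p \<psi> = measure_pmf.prob (edge_pmf n p) {X. holds (pair_graph n X) \<psi>}"
  by (simp add: Prob_def random_graph_def edge_pmf_def pair_graph_def vimage_def)

lemma finite_vertex_pairs [simp]: "finite (vertex_pairs n)"
proof (rule finite_subset)
  show "vertex_pairs n \<subseteq> {..n} \<times> {..n}" unfolding vertex_pairs_def by auto
qed simp

lemma edge_pmf_support:
  assumes "X \<in> set_pmf (edge_pmf n p)" "X (v, w)"
  shows "1 \<le> v" "v < w" "w \<le> n"
proof -
  have "(v, w) \<in> vertex_pairs n"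
    using subsetD[OF set_Pi_pmf_subset[OF finite_vertex_pairs] assms(1)[unfolded edge_pmf_def]] assms(2)
    by auto
  then show "1 \<le> v" "v < w" "w \<le> n" by (auto simp: vertex_pairs_def)
qed

lemma joined_support:
  assumes "X \<in> set_pmf (edge_pmf n p)" "v < w"
  shows "joined X v w \<longleftrightarrow> X (v, w)" "joined X w v \<longleftrightarrow> X (v, w)"
  using edge_pmf_support(2)[OF assms(1), of w v] assms(2) unfolding joined_def by auto

lemma joined_irrefl: "X \<in> set_pmf (edge_pmf n p) \<Longrightarrow> \<not> joined X v v"
  using edge_pmf_support(2)[of X n p v v] unfolding joined_def by auto

definition long_edge :: "nat \<Rightarrow> nat set \<Rightarrow> (nat \<times> nat \<Rightarrow> bool) \<Rightarrow> bool" where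
  "long_edge d V X \<longleftrightarrow> (\<exists>v\<in>V. \<exists>w. joined X v w \<and> (v + d < w \<or> w + d < v))"

text \<open>
  The lower bound \<open>P\<close> for all partial products stands for the positive infinite product.
\<close>

locale edge_probabilities =
  fixes p :: "nat \<Rightarrow> real" and P :: real
  assumes p_nonneg: "1 \<le> i \<Longrightarrow> 0 \<le> p i" and p_less_1: "1 \<le> i \<Longrightarrow> p i < 1"
    and P_pos: "0 < P" and P_le_prod: "P \<le> (\<Prod>i=1..n. 1 - p i)"
begin

text \<open>
  The product is the probability that a vertex has no edge to the vertices that follow it at the
  distances in \<open>J\<close>.
\<close>

lemma P_le_prod_subset:
  assumes "finite J" "J \<subseteq> {1..}"
  shows "P \<le> (\<Prod>i\<in>J. 1 - p i)"
proof -
  obtain n where "\<forall>j\<in>J. j \<le> n" using assms(1) unfolding finite_nat_set_iff_bounded_le by blast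
  then have J: "J \<subseteq> {1..n}" using assms(2) by auto
  have "P \<le> (\<Prod>i=1..n. 1 - p i)" by (rule P_le_prod)
  also have "\<dots> = (\<Prod>i\<in>J. 1 - p i) * (\<Prod>i\<in>{1..n} - J. 1 - p i)"
    using prod.subset_diff[OF J, of "\<lambda>i. 1 - p i"] by (simp add: mult.commute)
  also have "\<dots> \<le> (\<Prod>i\<in>J. 1 - p i) * 1"
  proof (rule mult_left_mono)
    show "(\<Prod>i\<in>{1..n} - J. 1 - p i) \<le> 1"
      by (rule prod_le_1) (use p_nonneg p_less_1 in \<open>auto intro: less_imp_le\<close>)
    show "0 \<le> (\<Prod>i\<in>J. 1 - p i)"
      by (rule prod_nonneg) (use p_less_1 assms in \<open>auto intro: less_imp_le\<close>)
  qed
  finally show ?thesis by simp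
qed

lemma summable_p: "summable (\<lambda>i. p (Suc i))"
proof (rule bounded_imp_summable)
  fix n
  have "P \<le> (\<Prod>i\<in>{1..Suc n}. 1 - p i)" by (rule P_le_prod)
  also have "\<dots> \<le> (\<Prod>i\<in>{1..Suc n}. exp (- p i))"
  proof (rule prod_mono)
    fix i assume "i \<in> {1..Suc n}"
    then show "0 \<le> 1 - p i \<and> 1 - p i \<le> exp (- p i)"
      using p_less_1[of i] exp_ge_add_one_self[of "- p i"] by auto
  qed
  also have "\<dots> = exp (- (\<Sum>i=1..Suc n. p i))" by (simp only: exp_sum finite_atLeastAtMost sum_negf[symmetric])
  finally have "ln P \<le> - (\<Sum>i=1..Suc n. p i)"
    using P_pos by (simp add: ln_le_cancel_iff[symmetric] del: ln_le_cancel_iff)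
  moreover have "(\<Sum>i=1..Suc n. p i) = (\<Sum>i\<le>n. p (Suc i))"
    using sum.shift_bounds_cl_Suc_ivl[of p 0 n] by (simp add: atLeast0AtMost)
  ultimately show "(\<Sum>i\<le>n. p (Suc i)) \<le> - ln P" by simp
qed (use p_nonneg in auto)

lemma small_tail:
  assumes "0 < \<eta>"
  shows "\<exists>d\<ge>1. \<forall>J. finite J \<and> J \<subseteq> {d<..} \<longrightarrow> (\<Sum>i\<in>J. p i) \<le> \<eta>"
proof -
  have "summable p" using summable_p by (simp add: summable_Suc_iff)
  then obtain d where d: "\<And>m n. m \<ge> d \<Longrightarrow> norm (\<Sum>i\<in>{m..<n}. p i) < \<eta>"
    using assms unfolding summable_Cauchy by blast
  have "(\<Sum>i\<in>J. p i) \<le> \<eta>" if J: "finite J" "J \<subseteq> {Suc d<..}" for J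
  proof -
    obtain n where "\<forall>j\<in>J. j < n" using J(1) unfolding finite_nat_set_iff_bounded by blast
    then have "J \<subseteq> {Suc d..<n}" using J(2) by auto
    then have "(\<Sum>i\<in>J. p i) \<le> (\<Sum>i\<in>{Suc d..<n}. p i)"
      by (rule sum_mono2[rotated]) (use p_nonneg in auto)
    also have "\<dots> \<le> \<eta>" using d[of "Suc d" n] by auto
    finally show ?thesis .
  qed
  then show ?thesis by (intro exI[of _ "Suc d"]) auto
qed

lemma prob_edge:
  assumes "(v, w) \<in> vertex_pairs n"
  shows "measure_pmf.prob (edge_pmf n p) {X. X (v, w)} = p (w - v)"
proof -
  have "v < w" using assms by (simp add: vertex_pairs_def)
  then have "1 \<le> w - v" by simp
  from p_nonneg[OF this] p_less_1[OF this] have "0 \<le> p (w - v)" "p (w - v) \<le> 1" by simp_all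
  then have "pmf (bernoulli_pmf (p (w - v))) True = p (w - v)" by simp
  then show ?thesis
    using prob_Pi_pmf_cylinder[OF finite_vertex_pairs, of "{(v, w)}" n False "\<lambda>(v, w). bernoulli_pmf (p (w - v))" "\<lambda>_. True"]
      assms unfolding edge_pmf_def by simp
qed

text \<open>
  Union bound: \<open>\<eta>\<close> bounds the expected number of edges longer than \<open>d\<close> from a given vertex to the
  right, and likewise to the left.
\<close>

lemma prob_long_edge:
  fixes \<eta> :: real
  assumes tail: "\<And>J. finite J \<Longrightarrow> J \<subseteq> {d<..} \<Longrightarrow> (\<Sum>i\<in>J. p i) \<le> \<eta>" and V: "finite V"
  shows "measure_pmf.prob (edge_pmf n p) {X. long_edge d V X} \<le> 2 * real (card V) * \<eta>"
proof -
  let ?P = "measure_pmf.prob (edge_pmf n p)"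
  define R where "R = (\<lambda>v. (\<lambda>w. (v, w)) ` {w. (v, w) \<in> vertex_pairs n \<and> v + d < w})"
  define L where "L = (\<lambda>v. (\<lambda>w. (w, v)) ` {w. (w, v) \<in> vertex_pairs n \<and> w + d < v})"
  have fin: "finite {w. (v, w) \<in> vertex_pairs n \<and> v + d < w}" "finite {w. (w, v) \<in> vertex_pairs n \<and> w + d < v}" for v
    by (rule finite_subset[of _ "{1..n}"]; auto simp: vertex_pairs_def)+
  then have finRL: "finite (R v \<union> L v)" for v by (auto simp: R_def L_def)
  have bound: "?P (\<Union>e\<in>R v \<union> L v. {X. X e}) \<le> 2 * \<eta>" for v
  proof -
    have sub: "R v \<subseteq> vertex_pairs n" "L v \<subseteq> vertex_pairs n" by (auto simp: R_def L_def)
    have "?P (\<Union>e\<in>R v \<union> L v. {X. X e}) \<le> (\<Sum>e\<in>R v \<union> L v. ?P {X. X e})"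
      by (rule measure_UNION_le) (use finRL in auto)
    also have "\<dots> = (\<Sum>e\<in>R v. ?P {X. X e}) + (\<Sum>e\<in>L v. ?P {X. X e})"
      using finRL[of v] by (intro sum.union_disjoint) (auto simp: R_def L_def vertex_pairs_def)
    also have "(\<Sum>e\<in>R v. ?P {X. X e}) = (\<Sum>w | (v, w) \<in> vertex_pairs n \<and> v + d < w. p (w - v))"
      unfolding R_def by (subst sum.reindex) (auto simp: inj_on_def prob_edge)
    also have "\<dots> = (\<Sum>i\<in>(\<lambda>w. w - v) ` {w. (v, w) \<in> vertex_pairs n \<and> v + d < w}. p i)"
      by (subst sum.reindex) (auto simp: inj_on_def)
    also have "\<dots> \<le> \<eta>" by (rule tail) (use fin in auto)
    also have "(\<Sum>e\<in>L v. ?P {X. X e}) = (\<Sum>w | (w, v) \<in> vertex_pairs n \<and> w + d < v. p (v - w))"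
      unfolding L_def by (subst sum.reindex) (auto simp: inj_on_def prob_edge)
    also have "\<dots> = (\<Sum>i\<in>(\<lambda>w. v - w) ` {w. (w, v) \<in> vertex_pairs n \<and> w + d < v}. p i)"
      by (subst sum.reindex) (auto simp: inj_on_def)
    also have "\<dots> \<le> \<eta>" by (rule tail) (use fin in auto)
    finally show ?thesis by simp
  qed
  have "?P {X. long_edge d V X} \<le> ?P (\<Union>v\<in>V. \<Union>e\<in>R v \<union> L v. {X. X e})"
  proof (rule prob_mono_support)
    fix X assume X: "X \<in> set_pmf (edge_pmf n p)" and "X \<in> {X. long_edge d V X}"
    then obtain v w where v: "v \<in> V" "joined X v w" "v + d < w \<or> w + d < v"
      by (auto simp: long_edge_def)
    from v(3) have "\<exists>e\<in>R v \<union> L v. X e"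
    proof
      assume "v + d < w"
      then have "X (v, w)" using v(2) joined_support[OF X, of v w] by simp
      moreover from edge_pmf_support[OF X this] have "(v, w) \<in> R v"
        using \<open>v + d < w\<close> by (auto simp: R_def vertex_pairs_def)
      ultimately show ?thesis by blast
    next
      assume "w + d < v"
      then have "X (w, v)" using v(2) joined_support[OF X, of w v] by simp
      moreover from edge_pmf_support[OF X this] have "(w, v) \<in> L v"
        using \<open>w + d < v\<close> by (auto simp: L_def vertex_pairs_def)
      ultimately show ?thesis by blast
    qed
    then show "X \<in> (\<Union>v\<in>V. \<Union>e\<in>R v \<union> L v. {X. X e})" using v(1) by auto
  qed
  also have "\<dots> \<le> (\<Sum>v\<in>V. ?P (\<Union>e\<in>R v \<union> L v. {X. X e}))"
    by (rule measure_UNION_le) (use V in auto)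
  also have "\<dots> \<le> (\<Sum>v\<in>V. 2 * \<eta>)" by (rule sum_mono) (rule bound)
  finally show ?thesis by (simp add: mult.assoc mult.left_commute)
qed

end

section \<open>Planted copies of a finite configuration\<close>

text \<open>
  As no edge leaves the window, only the successor relation at its two end points links the copy of
  \<open>Y\<close> to the rest of the graph, so away from these points local types in the copy are those in \<open>Y\<close>.
\<close>

definition planted :: "nat \<Rightarrow> (nat \<times> nat \<Rightarrow> bool) \<Rightarrow> nat \<Rightarrow> (nat \<times> nat \<Rightarrow> bool) \<Rightarrow> bool" where
  "planted k Y t X \<longleftrightarrow>
     (\<forall>v\<in>{1..k}. \<forall>w\<in>{1..k}. joined X (v + t) (w + t) \<longleftrightarrow> joined Y v w) \<and>
     (\<forall>v\<in>{t + 1..t + k}. \<forall>w. joined X v w \<longrightarrow> w \<in> {t + 1..t + k})"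

text \<open>
  A walk can leave the copy only through its first or last vertex, which are out of reach.
\<close>

lemma planted_nbhd:
  assumes pl: "planted k Y t X" and t: "t + k \<le> n" and a: "a \<in> {1..k}"
    and far: "nbhd (pair_graph k Y) r {a} \<inter> {1, k} = {}"
  shows "nbhd (pair_graph n X) r {a + t} \<subseteq> (\<lambda>x. x + t) ` nbhd (pair_graph k Y) r {a}"
  using far
proof (induction r)
  case (Suc r)
  let ?M = "pair_graph k Y" and ?N = "pair_graph n X"
  have IH: "nbhd ?N r {a + t} \<subseteq> (\<lambda>x. x + t) ` nbhd ?M r {a}" using Suc by auto
  have U: "nbhd ?M r {a} \<subseteq> {1..k}" using nbhd_subset_universe[of "{a}" ?M r] a by simp
  have "y \<in> (\<lambda>x. x + t) ` nbhd ?M (Suc r) {a}" if x: "x \<in> nbhd ?M r {a}" and l: "linked ?N (x + t) y" for x y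
  proof -
    have "x \<noteq> 1" "x \<noteq> k" "x \<in> {1..k}" using x U Suc.prems by auto
    then have xk: "1 < x" "x < k" by auto
    consider "joined X (x + t) y" | "y = x + t + 1" | "x + t = y + 1"
      using l by (auto simp: linked_def joined_def)
    then have "\<exists>z. y = z + t \<and> linked ?M x z"
    proof cases
      case 1
      moreover have "x + t \<in> {t + 1..t + k}" using xk by auto
      ultimately have "y \<in> {t + 1..t + k}" using pl unfolding planted_def by blast
      then have z: "y = (y - t) + t" "y - t \<in> {1..k}" by auto
      then have "joined Y x (y - t)" using pl 1 xk unfolding planted_def by (metis atLeastAtMost_iff less_imp_le)
      then show ?thesis using z xk by (intro exI[of _ "y - t"]) (auto simp: linked_def)
    next
      case 2
      then show ?thesis using xk by (intro exI[of _ "x + 1"]) (auto simp: linked_def)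
    next
      case 3
      then show ?thesis using xk by (intro exI[of _ "x - 1"]) (auto simp: linked_def)
    qed
    then show ?thesis using x by auto
  qed
  then show ?case using IH by auto
qed simp

lemma planted_loc_eq:
  assumes pl: "planted k Y t X" and t: "t + k \<le> n" and a: "a \<in> {1..k}"
    and far: "nbhd (pair_graph k Y) (2^q) {a} \<inter> {1, k} = {}"
  shows "loc_eq q (pair_graph k Y) (pair_graph n X) {(a, a + t)}"
proof (rule loc_eq_local)
  let ?M = "pair_graph k Y" and ?N = "pair_graph n X"
  let ?F = "(\<lambda>x. (x, x + t)) ` {1..k}"
  show "partial_iso ?M ?N ?F"
    using pl by (intro partial_isoI) (auto simp: planted_def)
  show "?F \<subseteq> universe ?M \<times> universe ?N" "{(a, a + t)} \<subseteq> ?F" using t a by auto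
  have M: "nbhd ?M (2^q) {a} \<subseteq> {1..k}" using nbhd_subset_universe[of "{a}" ?M] a by simp
  then show "nbhd ?M (2^q) (fst ` {(a, a + t)}) \<subseteq> fst ` ?F" by (simp add: image_image)
  have "nbhd ?N (2^q) {a + t} \<subseteq> (\<lambda>x. x + t) ` {1..k}"
    using planted_nbhd[OF pl t a far] M by blast
  then show "nbhd ?N (2^q) (snd ` {(a, a + t)}) \<subseteq> snd ` ?F" by (simp add: image_image)
qed

definition copies :: "nat \<Rightarrow> nat \<Rightarrow> (nat \<times> nat \<Rightarrow> bool) \<Rightarrow> nat \<Rightarrow> (nat \<times> nat \<Rightarrow> bool) \<Rightarrow> bool" where
  "copies m k Y n X \<longleftrightarrow> (\<exists>t. (\<forall>i<m. planted k Y (t i) X \<and> t i + k \<le> n) \<and> (\<forall>i j. i < j \<longrightarrow> j < m \<longrightarrow> t i + k \<le> t j))"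

text \<open>
  The copies are disjoint and outnumber the points of \<open>B\<close>, so one of them is free of such points, and
  the ball around its marked vertex stays inside it.
\<close>

lemma copies_avoiding:
  assumes "copies m k Y n X" "finite B" "card B < m"
    and a: "a \<in> {1..k}" and far: "nbhd (pair_graph k Y) (2^q) {a} \<inter> {1, k} = {}"
  shows "\<exists>b\<in>{1..n}. nbhd (pair_graph n X) (2^q) {b} \<inter> B = {} \<and> loc_eq q (pair_graph k Y) (pair_graph n X) {(a, b)}"
proof -
  obtain t where t: "\<And>i. i < m \<Longrightarrow> planted k Y (t i) X" "\<And>i. i < m \<Longrightarrow> t i + k \<le> n"
    "\<And>i j. i < j \<Longrightarrow> j < m \<Longrightarrow> t i + k \<le> t j"
    using assms(1) unfolding copies_def by blast
  \<comment> \<open>Otherwise choosing a point of \<open>B\<close> in each window gives an injection into \<open>B\<close>.\<close>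
  have "\<exists>i<m. {t i + 1..t i + k} \<inter> B = {}"
  proof (rule ccontr)
    assume "\<not> ?thesis"
    then have "\<forall>i. \<exists>b. i < m \<longrightarrow> b \<in> {t i + 1..t i + k} \<inter> B" by blast
    then obtain f where f: "\<And>i. i < m \<Longrightarrow> f i \<in> {t i + 1..t i + k} \<inter> B" by metis
    have lt: "f i < f j" if "i < j" "j < m" for i j
      using f[of i] f[of j] t(3)[OF that] that by auto
    have "inj_on f {..<m}" by (rule linorder_inj_onI) (use lt in force)+
    moreover have "f ` {..<m} \<subseteq> B" using f by blast
    ultimately have "m \<le> card B" using card_inj_on_le[of f "{..<m}" B] assms(2) by simp
    then show False using assms(3) by simp
  qed
  then obtain i where i: "i < m" "{t i + 1..t i + k} \<inter> B = {}" by blast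
  have "nbhd (pair_graph k Y) (2^q) {a} \<subseteq> {1..k}"
    using nbhd_subset_universe[of "{a}" "pair_graph k Y"] a by simp
  then have "nbhd (pair_graph n X) (2^q) {a + t i} \<subseteq> (\<lambda>x. x + t i) ` {1..k}"
    using planted_nbhd[OF t(1,2)[OF i(1)] a far] by blast
  also have "\<dots> \<subseteq> {t i + 1..t i + k}" by auto
  finally have "nbhd (pair_graph n X) (2^q) {a + t i} \<inter> B = {}" using i(2) by blast
  moreover have "a + t i \<in> {1..n}" using t(2)[OF i(1)] a by auto
  ultimately show ?thesis using planted_loc_eq[OF t(1,2)[OF i(1)] a far] by blast
qed

lemma prod_ge_power:
  fixes g :: "'a \<Rightarrow> real"
  assumes "\<And>x. x \<in> A \<Longrightarrow> c \<le> g x" "0 \<le> c"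
  shows "c ^ card A \<le> prod g A"
  using prod_mono[of A "\<lambda>_. c" g] assms by (simp add: prod_constant)

context edge_probabilities
begin

text \<open>
  The pairs whose state decides whether a copy is planted at \<open>t\<close>, as far as edges to vertices within
  distance \<open>L\<close> of the window \<open>{t + 1..t + k}\<close> are concerned: the pairs inside the window, those
  from its left margin into it, and those from it into its right margin. Truncation to margins
  makes the boxes of separated windows disjoint, hence independent.
\<close>

definition box :: "nat \<Rightarrow> nat \<Rightarrow> nat \<Rightarrow> (nat \<times> nat) set" where
  "box k L t = (\<lambda>(v, w). (v + t, w + t)) ` vertex_pairs k
     \<union> (\<lambda>(w, v). (v, w)) ` ({t + 1..t + k} \<times> {t - L + 1..t})
     \<union> {t + 1..t + k} \<times> {t + k + 1..t + k + L}"

definition box_pattern :: "nat \<Rightarrow> (nat \<times> nat \<Rightarrow> bool) \<Rightarrow> nat \<Rightarrow> nat \<times> nat \<Rightarrow> bool" where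
  "box_pattern k Y t = (\<lambda>(v, w). t < v \<and> w \<le> t + k \<and> Y (v - t, w - t))"

text \<open>
  The pairs inside the window show the pattern \<open>Y\<close> with the probability that \<open>Y\<close> has as a graph of
  its own. Each vertex of the window misses all vertices of a margin with probability at least
  \<open>P\<close>, whatever the width \<open>L\<close> of the margin.
\<close>

lemma prob_box:
  assumes "L \<le> t" "t + k + L \<le> n" and Y: "\<And>v w. Y (v, w) \<Longrightarrow> (v, w) \<in> vertex_pairs k"
  shows "pmf (edge_pmf k p) Y * (P ^ k * P ^ k)
       \<le> measure_pmf.prob (edge_pmf n p) {X. \<forall>e\<in>box k L t. X e = box_pattern k Y t e}"
proof -
  define D where "D = (\<lambda>(v, w). bernoulli_pmf (p (w - v)))"
  define g where "g = (\<lambda>e. pmf (D e) (box_pattern k Y t e))"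
  define B1 where "B1 = (\<lambda>(v, w). (v + t, w + t)) ` vertex_pairs k"
  define B2 where "B2 = (\<lambda>(w, v). (v, w)) ` ({t + 1..t + k} \<times> {t - L + 1..t})"
  define B3 where "B3 = {t + 1..t + k} \<times> {t + k + 1..t + k + L}"
  have box: "box k L t = B1 \<union> B2 \<union> B3" by (simp add: box_def B1_def B2_def B3_def)
  have B1: "finite B1" and B2: "finite B2" and B3: "finite B3"
    by (auto simp: B1_def B2_def B3_def)
  have sub: "B1 \<union> B2 \<union> B3 \<subseteq> vertex_pairs n"
    using assms(1,2) by (auto simp: B1_def B2_def B3_def vertex_pairs_def)
  have disj: "B1 \<inter> B2 = {}" "(B1 \<union> B2) \<inter> B3 = {}"
    by (auto simp: B1_def B2_def B3_def vertex_pairs_def)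
  have absent: "pmf (bernoulli_pmf (p i)) False = 1 - p i" if "1 \<le> i" for i
    using p_nonneg[OF that] p_less_1[OF that] by simp
  have "prod g B1 = (\<Prod>e\<in>vertex_pairs k. g (case e of (v, w) \<Rightarrow> (v + t, w + t)))"
    unfolding B1_def by (subst prod.reindex) (auto simp: inj_on_def)
  also have "\<dots> = (\<Prod>e\<in>vertex_pairs k. pmf (D e) (Y e))"
    by (rule prod.cong) (auto simp: g_def D_def box_pattern_def vertex_pairs_def)
  also have "\<dots> = pmf (edge_pmf k p) Y"
    unfolding edge_pmf_def D_def using Y by (subst pmf_Pi') auto
  finally have g1: "prod g B1 = pmf (edge_pmf k p) Y" .
  have "P ^ k \<le> prod g B2"
  proof -
    have "P \<le> (\<Prod>v\<in>{t - L + 1..t}. g (v, w))" if w: "w \<in> {t + 1..t + k}" for w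
    proof -
      have "P \<le> (\<Prod>i\<in>(\<lambda>v. w - v) ` {t - L + 1..t}. 1 - p i)"
        by (rule P_le_prod_subset) (use w in auto)
      also have "\<dots> = (\<Prod>v\<in>{t - L + 1..t}. 1 - p (w - v))"
        by (subst prod.reindex) (use w in \<open>auto simp: inj_on_def\<close>)
      also have "\<dots> = (\<Prod>v\<in>{t - L + 1..t}. g (v, w))"
        by (rule prod.cong) (use w absent in \<open>auto simp: g_def D_def box_pattern_def\<close>)
      finally show ?thesis .
    qed
    then have "P ^ card {t + 1..t + k} \<le> (\<Prod>w\<in>{t + 1..t + k}. \<Prod>v\<in>{t - L + 1..t}. g (v, w))"
      using P_pos by (intro prod_ge_power) auto
    also have "\<dots> = (\<Prod>x\<in>{t + 1..t + k} \<times> {t - L + 1..t}. g (case x of (w, v) \<Rightarrow> (v, w)))"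
      by (subst prod.cartesian_product) (auto intro!: prod.cong)
    also have "\<dots> = prod g B2"
      unfolding B2_def by (subst prod.reindex) (auto simp: inj_on_def)
    finally show ?thesis by simp
  qed
  moreover have "P ^ k \<le> prod g B3"
  proof -
    have "P \<le> (\<Prod>w\<in>{t + k + 1..t + k + L}. g (v, w))" if v: "v \<in> {t + 1..t + k}" for v
    proof -
      have "P \<le> (\<Prod>i\<in>(\<lambda>w. w - v) ` {t + k + 1..t + k + L}. 1 - p i)"
        by (rule P_le_prod_subset) (use v in auto)
      also have "\<dots> = (\<Prod>w\<in>{t + k + 1..t + k + L}. 1 - p (w - v))"
        by (subst prod.reindex) (use v in \<open>auto simp: inj_on_def\<close>)
      also have "\<dots> = (\<Prod>w\<in>{t + k + 1..t + k + L}. g (v, w))"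
        by (rule prod.cong) (use v absent in \<open>auto simp: g_def D_def box_pattern_def\<close>)
      finally show ?thesis .
    qed
    then have "P ^ card {t + 1..t + k} \<le> (\<Prod>v\<in>{t + 1..t + k}. \<Prod>w\<in>{t + k + 1..t + k + L}. g (v, w))"
      using P_pos by (intro prod_ge_power) auto
    also have "\<dots> = prod g B3"
      unfolding B3_def by (subst prod.cartesian_product) (auto intro!: prod.cong)
    finally show ?thesis by simp
  qed
  ultimately have "P ^ k * P ^ k \<le> prod g B2 * prod g B3"
    using P_pos by (intro mult_mono) (auto simp: g_def intro: prod_nonneg)
  then have "pmf (edge_pmf k p) Y * (P ^ k * P ^ k) \<le> prod g B1 * (prod g B2 * prod g B3)"
    unfolding g1 by (rule mult_left_mono) simp
  also have "\<dots> = prod g (B1 \<union> B2 \<union> B3)"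
    using B1 B2 B3 disj by (simp add: prod.union_disjoint mult.assoc)
  also have "\<dots> = measure_pmf.prob (edge_pmf n p) {X. \<forall>e\<in>box k L t. X e = box_pattern k Y t e}"
    unfolding box edge_pmf_def g_def D_def[symmetric]
    by (rule prob_Pi_pmf_cylinder[OF _ sub, symmetric]) simp
  finally show ?thesis .
qed

text \<open>
  Use \<open>m\<close> windows with margins \<open>L\<close>. First \<open>m\<close> is chosen so large that with high probability the
  prescribed pattern occurs in the box of one of them; this is possible because the lower bound
  \<open>\<delta>\<close> for the probability of a box does not depend on \<open>L\<close>. Then \<open>L\<close> is chosen so large that
  edges from the \<open>m\<close> windows to vertices beyond the margins are unlikely. The length \<open>l = m * s\<close>
  does not depend on the place \<open>x\<close>, nor on \<open>n\<close>.
\<close>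

lemma prob_no_planted_copy:
  assumes \<epsilon>: "0 < \<epsilon>" and Y: "Y \<in> set_pmf (edge_pmf k p)"
  shows "\<exists>l. \<forall>x n. x + l \<le> n \<longrightarrow>
    measure_pmf.prob (edge_pmf n p) {X. \<not> (\<exists>t. x \<le> t \<and> t + k \<le> x + l \<and> planted k Y t X)} \<le> \<epsilon>"
proof -
  define \<delta> where "\<delta> = pmf (edge_pmf k p) Y * (P ^ k * P ^ k)"
  have Ysupp: "(v, w) \<in> vertex_pairs k" if "Y (v, w)" for v w
    using edge_pmf_support[OF Y that] by (simp add: vertex_pairs_def)
  have "0 < \<delta>" using Y P_pos by (simp add: \<delta>_def pmf_positive)
  have "P \<le> 1" using P_le_prod[of 0] by simp
  then have "P ^ k * P ^ k \<le> 1"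
    using P_pos by (intro mult_le_one power_le_one) auto
  then have "\<delta> \<le> 1" unfolding \<delta>_def using P_pos by (intro mult_le_one[OF pmf_le_1]) auto
  then obtain m where m: "(1 - \<delta>) ^ m < \<epsilon> / 2"
    using real_arch_pow_inv[of "\<epsilon> / 2" "1 - \<delta>"] \<epsilon> \<open>0 < \<delta>\<close> by auto
  \<comment> \<open>At most \<open>m * k\<close> vertices lie in the windows; the added 1 avoids division by zero.\<close>
  define \<eta> where "\<eta> = \<epsilon> / (4 * (real (m * k) + 1))"
  have "0 < \<eta>" using \<epsilon> by (simp add: \<eta>_def add_nonneg_pos)
  obtain L where "\<forall>J. finite J \<and> J \<subseteq> {L<..} \<longrightarrow> (\<Sum>i\<in>J. p i) \<le> \<eta>"
    using small_tail[OF \<open>0 < \<eta>\<close>] by blast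
  then have tail: "(\<Sum>i\<in>J. p i) \<le> \<eta>" if "finite J" "J \<subseteq> {L<..}" for J
    using that by blast
  define s where "s = L + k + L"
  have "measure_pmf.prob (edge_pmf n p) {X. \<not> (\<exists>t. x \<le> t \<and> t + k \<le> x + m * s \<and> planted k Y t X)} \<le> \<epsilon>"
    if n: "x + m * s \<le> n" for x n
  proof -
    let ?P = "measure_pmf.prob (edge_pmf n p)"
    define t where "t = (\<lambda>j. x + j * s + L)"
    define E where "E = (\<lambda>j. {X. \<forall>e\<in>box k L (t j). X e = box_pattern k Y (t j) e})"
    define V where "V = (\<Union>j<m. {t j + 1..t j + k})"
    have fit: "t j + k + L \<le> x + m * s" if "j < m" for j
    proof -
      have "Suc j * s \<le> m * s" using that by (intro mult_right_mono) auto
      then show ?thesis by (simp add: t_def s_def)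
    qed
    have sep: "t i + s \<le> t j" if "i < j" for i j
    proof -
      have "Suc i * s \<le> j * s" using that by (intro mult_right_mono) auto
      then show ?thesis by (simp add: t_def)
    qed
    have range: "t j < v + L \<and> v < w \<and> w \<le> t j + k + L" if "(v, w) \<in> box k L (t j)" for j v w
      using that by (auto simp: box_def vertex_pairs_def)
    have none: "?P {X. \<forall>j<m. X \<notin> E j} \<le> \<epsilon> / 2"
    proof -
      have "?P {X. \<forall>j<m. X \<notin> E j} \<le> (1 - \<delta>) ^ m"
        unfolding edge_pmf_def
      proof (rule prob_Pi_pmf_none[where Q = "\<lambda>j. box k L (t j)"])
        show "box k L (t j) \<subseteq> vertex_pairs n" if "j < m" for j
        proof
          fix e assume e: "e \<in> box k L (t j)"
          obtain v w where "e = (v, w)" by (cases e)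
          then show "e \<in> vertex_pairs n"
            using range[of v w j] e fit[OF that] n by (simp add: vertex_pairs_def t_def)
        qed
        show "box k L (t i) \<inter> box k L (t j) = {}" if "i < j" "j < m" for i j
        proof -
          have False if "(v, w) \<in> box k L (t i)" "(v, w) \<in> box k L (t j)" for v w
            using range[OF that(1)] range[OF that(2)] sep[OF \<open>i < j\<close>] unfolding s_def by linarith
          then show ?thesis by auto
        qed
        show "Z \<in> E j" if "\<And>e. e \<in> box k L (t j) \<Longrightarrow> X e = Z e" "X \<in> E j" for j X Z
          using that by (auto simp: E_def)
        show "\<delta> \<le> measure_pmf.prob (Pi_pmf (vertex_pairs n) False (\<lambda>(v, w). bernoulli_pmf (p (w - v)))) (E j)"
          if "j < m" for j
          unfolding \<delta>_def E_def edge_pmf_def[symmetric]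
          by (rule prob_box) (use fit[OF that] n Ysupp in \<open>auto simp: t_def\<close>)
      qed simp
      then show ?thesis using m by linarith
    qed
    have long: "?P {X. long_edge L V X} \<le> \<epsilon> / 2"
    proof -
      have V: "finite V" "card V \<le> m * k"
        using card_UN_le[of "{..<m}" "\<lambda>j. {t j + 1..t j + k}"] by (auto simp: V_def)
      have "?P {X. long_edge L V X} \<le> 2 * real (card V) * \<eta>"
        by (rule prob_long_edge[OF tail V(1)])
      also have "\<dots> \<le> 2 * (real (m * k) + 1) * \<eta>"
      proof (rule mult_right_mono)
        have "real (card V) \<le> real (m * k)" using V(2) by (simp only: of_nat_le_iff)
        also have "\<dots> \<le> real (m * k) + 1" by simp
        finally show "2 * real (card V) \<le> 2 * (real (m * k) + 1)" by (rule mult_left_mono) simp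
      qed (use \<open>0 < \<eta>\<close> in simp)
      also have "\<dots> = \<epsilon> / 2"
        by (simp add: \<eta>_def field_simps add_nonneg_eq_0_iff)
      finally show ?thesis .
    qed
    have "?P {X. \<not> (\<exists>t. x \<le> t \<and> t + k \<le> x + m * s \<and> planted k Y t X)}
        \<le> ?P ({X. \<forall>j<m. X \<notin> E j} \<union> {X. long_edge L V X})"
    proof (rule prob_mono_support, rule ccontr)
      fix X assume X: "X \<in> set_pmf (edge_pmf n p)"
        and no: "X \<in> {X. \<not> (\<exists>t. x \<le> t \<and> t + k \<le> x + m * s \<and> planted k Y t X)}"
        and "X \<notin> {X. \<forall>j<m. X \<notin> E j} \<union> {X. long_edge L V X}"
      then obtain j where j: "j < m" "X \<in> E j" and short: "\<not> long_edge L V X" by auto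
      have eq: "X e = box_pattern k Y (t j) e" if "e \<in> box k L (t j)" for e
        using j(2) that by (auto simp: E_def)
      have "planted k Y (t j) X"
        unfolding planted_def
      proof (intro conjI ballI allI impI)
        have lt: "X (v + t j, w + t j) \<longleftrightarrow> Y (v, w)" if "v \<in> {1..k}" "w \<in> {1..k}" "v < w" for v w
        proof -
          have "(v + t j, w + t j) \<in> box k L (t j)" using that by (auto simp: box_def vertex_pairs_def)
          then show ?thesis using that eq by (simp add: box_pattern_def)
        qed
        fix v w assume vw: "v \<in> {1..k}" "w \<in> {1..k}"
        show "joined X (v + t j) (w + t j) \<longleftrightarrow> joined Y v w"
        proof (cases v w rule: linorder_cases)
          case less
          then show ?thesis
            using lt[OF vw] joined_support[OF X, of "v + t j" "w + t j"] joined_support[OF Y, of v w] by simp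
        next
          case equal
          then show ?thesis using joined_irrefl[OF X] joined_irrefl[OF Y] by simp
        next
          case greater
          then show ?thesis
            using lt[OF vw(2,1)] joined_support[OF X, of "w + t j" "v + t j"] joined_support[OF Y, of w v] by simp
        qed
      next
        fix v w assume v: "v \<in> {t j + 1..t j + k}" and vw: "joined X v w"
        have "v \<in> V" using v j(1) by (auto simp: V_def)
        then have "\<not> v + L < w" "\<not> w + L < v" using short vw unfolding long_edge_def by blast+
        then have near: "w \<le> v + L" "v \<le> w + L" by simp_all
        show "w \<in> {t j + 1..t j + k}"
        proof (rule ccontr)
          assume "w \<notin> {t j + 1..t j + k}"
          then consider "w \<le> t j" | "t j + k < w" by fastforce
          then show False
          proof cases
            case 1
            then have "X (w, v)" using vw v joined_support[OF X, of w v] by simp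
            moreover have "(w, v) \<in> (\<lambda>(w, v). (v, w)) ` ({t j + 1..t j + k} \<times> {t j - L + 1..t j})"
              by (rule image_eqI[of _ _ "(v, w)"]) (use 1 near v in \<open>auto simp: t_def\<close>)
            then have "(w, v) \<in> box k L (t j)" unfolding box_def by blast
            ultimately show False using eq[of "(w, v)"] 1 by (simp add: box_pattern_def)
          next
            case 2
            then have "X (v, w)" using vw v joined_support[OF X, of v w] by simp
            moreover have "(v, w) \<in> box k L (t j)" using 2 near v by (simp add: box_def)
            ultimately show False using eq[of "(v, w)"] 2 by (simp add: box_pattern_def)
          qed
        qed
      qed
      moreover have "x \<le> t j" "t j + k \<le> x + m * s" using fit[OF j(1)] by (auto simp: t_def)
      ultimately show False using no by blast
    qed
    also have "\<dots> \<le> \<epsilon> / 2 + \<epsilon> / 2"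
      using prob_Un_le none long by (rule order_trans[OF _ add_mono])
    finally show ?thesis by simp
  qed
  then show ?thesis by blast
qed

end

section \<open>The two ends of the graph\<close>

definition near_ends :: "nat \<Rightarrow> nat \<Rightarrow> nat set" where
  "near_ends L n = {x. 1 \<le> x \<and> x \<le> n \<and> (x \<le> L \<or> n < x + L)}"

text \<open>
  The index set is the same for all \<open>n\<close>, so that graphs of different sizes can be compared; the Boolean
  distinguishes the left end from the right end.
\<close>

definition ends_restriction :: "nat \<Rightarrow> nat \<Rightarrow> (nat \<times> nat \<Rightarrow> bool) \<Rightarrow> bool \<times> nat \<times> nat \<Rightarrow> bool" where
  "ends_restriction L n X = (\<lambda>(b, v, w). (v, w) \<in> vertex_pairs L \<and>
     X (if b then (v, w) else (v + (n - L), w + (n - L))))"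

text \<open>
  If the balls around the constants stay within the ends and no edges join the two ends, then the
  identity on the left end together with a shift on the right end is a partial isomorphism that
  covers these balls.
\<close>

lemma ends_loc_eq:
  assumes X: "X \<in> set_pmf (edge_pmf n p)" and Y: "Y \<in> set_pmf (edge_pmf m p)"
    and n: "2 * L + d + 1 < n" and m: "2 * L + d + 1 < m" and L: "1 \<le> L"
    and nX: "nbhd (pair_graph n X) (2^q) {1, n} \<subseteq> near_ends L n"
    and nY: "nbhd (pair_graph m Y) (2^q) {1, m} \<subseteq> near_ends L m"
    and lX: "\<not> long_edge d (near_ends L n) X" and lY: "\<not> long_edge d (near_ends L m) Y"
    and eq: "ends_restriction L n X = ends_restriction L m Y"
  shows "loc_eq q (pair_graph n X) (pair_graph m Y) {(1, 1), (n, m)}"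
proof (rule loc_eq_local)
  define \<sigma> where "\<sigma> = (\<lambda>n b x. if b then x else x + (n - L))"
  define F where "F = (\<lambda>(b, x). (\<sigma> n b x, \<sigma> m b x)) ` (UNIV \<times> {1..L})"
  have lt: "joined X (\<sigma> n b x) (\<sigma> n b y) \<longleftrightarrow> joined Y (\<sigma> m b x) (\<sigma> m b y)"
    if "x \<in> {1..L}" "y \<in> {1..L}" "x < y" for b x y
  proof -
    have xy: "(x, y) \<in> vertex_pairs L" using that by (simp add: vertex_pairs_def)
    have "joined X (\<sigma> n b x) (\<sigma> n b y) \<longleftrightarrow> ends_restriction L n X (b, x, y)"
      using xy joined_support(1)[OF X, of "\<sigma> n b x" "\<sigma> n b y"] that(3) by (simp add: ends_restriction_def \<sigma>_def)
    also have "\<dots> \<longleftrightarrow> joined Y (\<sigma> m b x) (\<sigma> m b y)"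
      unfolding eq
      using xy joined_support(1)[OF Y, of "\<sigma> m b x" "\<sigma> m b y"] that(3) by (simp add: ends_restriction_def \<sigma>_def)
    finally show ?thesis .
  qed
  have sym: "joined Z v w \<longleftrightarrow> joined Z w v" for Z v w by (auto simp: joined_def)
  have same: "joined X (\<sigma> n b x) (\<sigma> n b y) \<longleftrightarrow> joined Y (\<sigma> m b x) (\<sigma> m b y)"
    if "x \<in> {1..L}" "y \<in> {1..L}" for b x y
  proof (cases x y rule: linorder_cases)
    case less
    then show ?thesis using lt that by simp
  next
    case equal
    then show ?thesis using joined_irrefl[OF X] joined_irrefl[OF Y] by simp
  next
    case greater
    then show ?thesis using lt[OF that(2,1)] sym[of X] sym[of Y] by metis
  qed
  have apart: "x + d + 1 < y + (n - L)" "x + d + 1 < y + (m - L)" if "x \<in> {1..L}" "y \<in> {1..L}" for x y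
    using that n m by auto
  have no_cross: "\<not> joined X x (y + (n - L))" "\<not> joined Y x (y + (m - L))"
    if "x \<in> {1..L}" "y \<in> {1..L}" for x y
  proof -
    have "x \<in> near_ends L n" "x \<in> near_ends L m" using that n m by (auto simp: near_ends_def)
    moreover have "x + d < y + (n - L)" "x + d < y + (m - L)" using apart[OF that] by simp_all
    ultimately show "\<not> joined X x (y + (n - L))" "\<not> joined Y x (y + (m - L))"
      using lX lY unfolding long_edge_def by blast+
  qed
  show "partial_iso (pair_graph n X) (pair_graph m Y) F"
  proof (rule partial_isoI)
    fix u u' v v' assume "(u, u') \<in> F" "(v, v') \<in> F"
    then obtain b x c y where x: "x \<in> {1..L}" "u = \<sigma> n b x" "u' = \<sigma> m b x"
      and y: "y \<in> {1..L}" "v = \<sigma> n c y" "v' = \<sigma> m c y"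
      unfolding F_def by (elim imageE SigmaE) simp
    consider "b = c" | "b" "\<not> c" | "\<not> b" "c" by blast
    then show "(u = v \<longleftrightarrow> u' = v') \<and> (adj_rel (pair_graph n X) u v \<longleftrightarrow> adj_rel (pair_graph m Y) u' v') \<and>
        (succ_rel (pair_graph n X) u v \<longleftrightarrow> succ_rel (pair_graph m Y) u' v')"
    proof cases
      case 1
      then show ?thesis using same[OF x(1) y(1), of b] x y by (simp add: \<sigma>_def)
    next
      case 2
      then show ?thesis using no_cross[OF x(1) y(1)] apart[OF x(1) y(1)] x(2,3) y(2,3) by (simp add: \<sigma>_def)
    next
      case 3
      then show ?thesis using no_cross[OF y(1) x(1)] apart[OF y(1) x(1)] x(2,3) y(2,3)
        by (simp add: \<sigma>_def sym[of X "_ + _"] sym[of Y "_ + _"])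
    qed
  qed
  show "F \<subseteq> universe (pair_graph n X) \<times> universe (pair_graph m Y)"
    using n m by (auto simp: F_def \<sigma>_def)
  have mem: "(\<sigma> n b x, \<sigma> m b x) \<in> F" if "x \<in> {1..L}" for b x using that by (auto simp: F_def)
  show "{(1, 1), (n, m)} \<subseteq> F"
    using mem[of 1 True] mem[of L False] L n m by (simp add: \<sigma>_def)
  have cov: "\<exists>b x. x \<in> {1..L} \<and> y = \<sigma> k b x" if "y \<in> near_ends L k" "2 * L < k" for y k
  proof (cases "y \<le> L")
    case True
    then show ?thesis using that by (intro exI[of _ True] exI[of _ y]) (simp add: near_ends_def \<sigma>_def)
  next
    case False
    then show ?thesis using that
      by (intro exI[of _ False] exI[of _ "y - (k - L)"]) (auto simp: near_ends_def \<sigma>_def)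
  qed
  have "near_ends L n \<subseteq> fst ` F" using cov[of _ n] n mem by force
  then show "nbhd (pair_graph n X) (2^q) (fst ` {(1, 1), (n, m)}) \<subseteq> fst ` F" using nX by simp
  have "near_ends L m \<subseteq> snd ` F" using cov[of _ m] m mem by force
  then show "nbhd (pair_graph m Y) (2^q) (snd ` {(1, 1), (n, m)}) \<subseteq> snd ` F" using nY by simp
qed

lemma ends_restriction_law:
  assumes "2 * L \<le> n"
  shows "map_pmf (ends_restriction L n) (edge_pmf n p)
       = Pi_pmf (UNIV \<times> vertex_pairs L) False (\<lambda>(b, v, w). bernoulli_pmf (p (w - v)))"
proof -
  define h where "h = (\<lambda>(b, v, w). if b then (v, w) else (v + (n - L), w + (n - L)))"
  let ?I = "(UNIV :: bool set) \<times> vertex_pairs L"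
  have "inj_on h ?I" "h ` ?I \<subseteq> vertex_pairs n"
    using assms by (auto simp: h_def inj_on_def vertex_pairs_def split: if_splits)
  from Pi_pmf_reindex[OF finite_vertex_pairs this, of False "\<lambda>(v, w). bernoulli_pmf (p (w - v))"]
  have "map_pmf (\<lambda>X i. if i \<in> ?I then X (h i) else False) (edge_pmf n p)
      = Pi_pmf ?I False (\<lambda>i. case h i of (v, w) \<Rightarrow> bernoulli_pmf (p (w - v)))"
    unfolding edge_pmf_def .
  moreover have "(\<lambda>X i. if i \<in> ?I then X (h i) else False) = ends_restriction L n"
    by (auto simp: fun_eq_iff ends_restriction_def h_def)
  moreover have "(\<lambda>i. case h i of (v, w) \<Rightarrow> bernoulli_pmf (p (w - v))) = (\<lambda>(b, v, w). bernoulli_pmf (p (w - v)))"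
    by (auto simp: fun_eq_iff h_def)
  ultimately show ?thesis by simp
qed

section \<open>Properties that hold with high probability\<close>

context edge_probabilities
begin

definition whp :: "(nat \<Rightarrow> (nat \<times> nat \<Rightarrow> bool) \<Rightarrow> bool) \<Rightarrow> bool" where
  "whp S \<longleftrightarrow> (\<forall>\<epsilon>>0. \<exists>N. \<forall>n\<ge>N. measure_pmf.prob (edge_pmf n p) {X. \<not> S n X} \<le> \<epsilon>)"

lemma whp_mono:
  assumes "whp S" "\<And>n X. X \<in> set_pmf (edge_pmf n p) \<Longrightarrow> S n X \<Longrightarrow> S' n X"
  shows "whp S'"
proof -
  have "measure_pmf.prob (edge_pmf n p) {X. \<not> S' n X} \<le> measure_pmf.prob (edge_pmf n p) {X. \<not> S n X}" for n
    by (rule prob_mono_support) (use assms(2) in auto)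
  then show ?thesis using assms(1) unfolding whp_def by (meson order_trans)
qed

lemma whp_conj:
  assumes "whp S" "whp S'"
  shows "whp (\<lambda>n X. S n X \<and> S' n X)"
  unfolding whp_def
proof (intro allI impI)
  fix \<epsilon> :: real assume "0 < \<epsilon>"
  then have "0 < \<epsilon> / 2" by simp
  obtain N where N: "\<And>n. N \<le> n \<Longrightarrow> measure_pmf.prob (edge_pmf n p) {X. \<not> S n X} \<le> \<epsilon> / 2"
    using assms(1) \<open>0 < \<epsilon> / 2\<close> unfolding whp_def by metis
  obtain N' where N': "\<And>n. N' \<le> n \<Longrightarrow> measure_pmf.prob (edge_pmf n p) {X. \<not> S' n X} \<le> \<epsilon> / 2"
    using assms(2) \<open>0 < \<epsilon> / 2\<close> unfolding whp_def by metis
  have "measure_pmf.prob (edge_pmf n p) {X. \<not> (S n X \<and> S' n X)} \<le> \<epsilon>" if "max N N' \<le> n" for n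
  proof -
    have "{X. \<not> (S n X \<and> S' n X)} = {X. \<not> S n X} \<union> {X. \<not> S' n X}" by auto
    then have "measure_pmf.prob (edge_pmf n p) {X. \<not> (S n X \<and> S' n X)}
        \<le> measure_pmf.prob (edge_pmf n p) {X. \<not> S n X} + measure_pmf.prob (edge_pmf n p) {X. \<not> S' n X}"
      by (simp only: prob_Un_le)
    also have "\<dots> \<le> \<epsilon> / 2 + \<epsilon> / 2" using N[of n] N'[of n] that by (intro add_mono) simp_all
    finally show ?thesis by simp
  qed
  then show "\<exists>N. \<forall>n\<ge>N. measure_pmf.prob (edge_pmf n p) {X. \<not> (S n X \<and> S' n X)} \<le> \<epsilon>" by blast
qed

lemma whp_ball:
  assumes "finite W" "\<And>w. w \<in> W \<Longrightarrow> whp (S w)"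
  shows "whp (\<lambda>n X. \<forall>w\<in>W. S w n X)"
  using assms
proof (induction W rule: finite_induct)
  case empty
  then show ?case by (simp add: whp_def)
next
  case (insert w W)
  then have "whp (\<lambda>n X. S w n X \<and> (\<forall>w\<in>W. S w n X))" by (intro whp_conj) simp_all
  then show ?case by simp
qed

lemma whp_copies:
  assumes Y: "Y \<in> set_pmf (edge_pmf k p)"
  shows "whp (copies m k Y)"
  unfolding whp_def
proof (intro allI impI)
  fix \<epsilon> :: real assume \<epsilon>: "0 < \<epsilon>"
  show "\<exists>N. \<forall>n\<ge>N. measure_pmf.prob (edge_pmf n p) {X. \<not> copies m k Y n X} \<le> \<epsilon>"
  proof (cases "m = 0")
    case True
    then show ?thesis using \<epsilon> by (simp add: copies_def)
  next
    case False
    then have "0 < \<epsilon> / real m" using \<epsilon> by simp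
    from prob_no_planted_copy[OF this Y] obtain l where l: "\<And>x n. x + l \<le> n \<Longrightarrow>
        measure_pmf.prob (edge_pmf n p) {X. \<not> (\<exists>t. x \<le> t \<and> t + k \<le> x + l \<and> planted k Y t X)} \<le> \<epsilon> / real m"
      by blast
    have "measure_pmf.prob (edge_pmf n p) {X. \<not> copies m k Y n X} \<le> \<epsilon>" if n: "m * l \<le> n" for n
    proof -
      let ?P = "measure_pmf.prob (edge_pmf n p)"
      define F where "F = (\<lambda>i. {X. \<not> (\<exists>t. i * l \<le> t \<and> t + k \<le> i * l + l \<and> planted k Y t X)})"
      have fit: "i * l + l \<le> j * l" if "i < j" for i j
      proof -
        have "Suc i * l \<le> j * l" using that by (intro mult_right_mono) auto
        then show ?thesis by simp
      qed
      have "X \<in> (\<Union>i<m. F i)" if "\<not> copies m k Y n X" for X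
      proof (rule ccontr)
        assume "X \<notin> (\<Union>i<m. F i)"
        then have "\<forall>i. \<exists>t. i < m \<longrightarrow> i * l \<le> t \<and> t + k \<le> i * l + l \<and> planted k Y t X"
          by (auto simp: F_def)
        then obtain t where t: "\<And>i. i < m \<Longrightarrow> i * l \<le> t i \<and> t i + k \<le> i * l + l \<and> planted k Y (t i) X"
          by metis
        have "copies m k Y n X"
          unfolding copies_def
        proof (intro exI[of _ t] conjI allI impI)
          fix i assume i: "i < m"
          show "planted k Y (t i) X" using t[OF i] by blast
          show "t i + k \<le> n" using t[OF i] fit[OF i] n by linarith
        next
          fix i j assume ij: "i < j" "j < m"
          show "t i + k \<le> t j" using t[of i] t[of j] fit[OF ij(1)] ij by linarith
        qed
        then show False using that by simp
      qed
      then have "?P {X. \<not> copies m k Y n X} \<le> ?P (\<Union>i<m. F i)"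
        by (intro prob_mono_support) blast
      also have "\<dots> \<le> (\<Sum>i<m. ?P (F i))" by (rule measure_UNION_le) auto
      also have "\<dots> \<le> (\<Sum>i<m. \<epsilon> / real m)"
      proof (rule sum_mono)
        fix i assume "i \<in> {..<m}"
        then show "?P (F i) \<le> \<epsilon> / real m"
          unfolding F_def using fit[of i m] n by (intro l) simp
      qed
      also have "\<dots> = \<epsilon>" using False by simp
      finally show ?thesis .
    qed
    then show ?thesis by blast
  qed
qed

text \<open>
  The graph \<open>Y\<close> to be matched is arbitrary, so that a single event for \<open>X\<close> serves for comparisons with
  random graphs of every other size.
\<close>

definition plentiful :: "nat \<Rightarrow> nat \<Rightarrow> nat \<Rightarrow> (nat \<times> nat \<Rightarrow> bool) \<Rightarrow> bool" where
  "plentiful Q K n X \<longleftrightarrow> (\<forall>k. \<forall>Y\<in>set_pmf (edge_pmf k p). rich Q K (pair_graph k Y) (pair_graph n X))"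

text \<open>
  Finitely many local types occur away from the end points of graphs of positive probability. Each is
  represented by some finite graph \<open>Y\<close> with a marked vertex, and \<open>Suc K\<close> disjoint planted copies of
  \<open>Y\<close> contain the required answer.
\<close>

lemma whp_plentiful: "whp (plentiful Q K)"
proof -
  define T where "T = (\<lambda>q. {(pair_graph k Y, a) | k Y a. Y \<in> set_pmf (edge_pmf k p) \<and> a \<in> {1..k} \<and>
     nbhd (pair_graph k Y) (2^q) {a} \<inter> {1, k} = {}})"
  define S where "S = (\<lambda>q (M :: nat lp_struct, a :: nat) n X. \<forall>B. finite B \<and> card B \<le> K \<longrightarrow>
     (\<exists>b\<in>{1..n}. nbhd (pair_graph n X) (2^q) {b} \<inter> B = {} \<and> loc_eq q M (pair_graph n X) {(a, b)}))"
  have "\<forall>q. \<exists>W\<subseteq>T q. finite W \<and> (\<forall>(M, a)\<in>T q. \<exists>(N, b)\<in>W. loc_eq q M N {(a, b)})"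
    by (intro allI loc_eq_finite_representatives)
  from choice[OF this] obtain W
    where "\<forall>q. W q \<subseteq> T q \<and> finite (W q) \<and> (\<forall>(M, a)\<in>T q. \<exists>(N, b)\<in>W q. loc_eq q M N {(a, b)})"
    by (rule exE)
  then have W: "W q \<subseteq> T q" "finite (W q)" "\<forall>(M, a)\<in>T q. \<exists>(N, b)\<in>W q. loc_eq q M N {(a, b)}" for q
    by blast+
  have "whp (S q w)" if w: "w \<in> W q" for q w
  proof -
    obtain k Y a where kYa: "w = (pair_graph k Y, a)" "Y \<in> set_pmf (edge_pmf k p)" "a \<in> {1..k}"
      "nbhd (pair_graph k Y) (2^q) {a} \<inter> {1, k} = {}"
      using subsetD[OF W(1) w] unfolding T_def by blast
    show ?thesis
    proof (rule whp_mono[OF whp_copies[OF kYa(2), of "Suc K"]])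
      fix n X assume "copies (Suc K) k Y n X"
      then show "S q w n X"
        unfolding S_def kYa(1) using copies_avoiding[OF _ _ _ kYa(3,4)] by (auto simp: less_Suc_eq_le)
    qed
  qed
  then have "whp (\<lambda>n X. \<forall>q\<in>{..<Q}. \<forall>w\<in>W q. S q w n X)"
    by (intro whp_ball) (use W(2) in auto)
  then show ?thesis
  proof (rule whp_mono)
    fix n X assume all: "\<forall>q\<in>{..<Q}. \<forall>w\<in>W q. S q w n X"
    show "plentiful Q K n X"
      unfolding plentiful_def rich_def
    proof (intro allI ballI impI)
      fix k Y q a and B :: "nat set"
      assume Y: "Y \<in> set_pmf (edge_pmf k p)" and q: "q < Q" and a: "a \<in> universe (pair_graph k Y)"
        and far: "nbhd (pair_graph k Y) (2^q) {first_elem (pair_graph k Y), last_elem (pair_graph k Y)} \<inter> {a} = {}"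
        and B: "finite B \<and> card B \<le> K"
      have "nbhd (pair_graph k Y) (2^q) {a} \<inter> {1, k} = {}"
        using far nbhd_disjoint_sym[of "pair_graph k Y" "2^q" "{1, k}" "{a}"] by auto
      then have "(pair_graph k Y, a) \<in> T q" using Y a unfolding T_def by auto
      then obtain N b where Nb: "(N, b) \<in> W q" "loc_eq q (pair_graph k Y) N {(a, b)}"
        using W(3)[of q] by blast
      then have "S q (N, b) n X" using all q by blast
      then obtain c where c: "c \<in> {1..n}" "nbhd (pair_graph n X) (2^q) {c} \<inter> B = {}" "loc_eq q N (pair_graph n X) {(b, c)}"
        using B unfolding S_def prod.case by blast
      then show "\<exists>b\<in>universe (pair_graph n X). nbhd (pair_graph n X) (2^q) {b} \<inter> B = {} \<and>
          loc_eq q (pair_graph k Y) (pair_graph n X) {(a, b)}"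
        using c(1,2) loc_eq_point_trans[OF Nb(2) c(3)] unfolding pair_graph_simps by blast
    qed
  qed
qed

lemma card_near_ends: "finite (near_ends L n)" "card (near_ends L n) \<le> 2 * L"
proof -
  have sub: "near_ends L n \<subseteq> {1..L} \<union> {n - L + 1..n}" by (auto simp: near_ends_def)
  then show "finite (near_ends L n)" by (rule finite_subset) simp
  have "card (near_ends L n) \<le> card ({1..L} \<union> {n - L + 1..n})" using sub by (intro card_mono) simp_all
  also have "\<dots> \<le> card {1..L} + card {n - L + 1..n}" by (rule card_Un_le)
  finally show "card (near_ends L n) \<le> 2 * L" by simp
qed

lemma small_prob_long_edge_near_ends:
  assumes "0 < \<epsilon>"
  shows "\<exists>d\<ge>1. \<forall>n. measure_pmf.prob (edge_pmf n p) {X. long_edge d (near_ends L n) X} \<le> \<epsilon>"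
proof -
  define \<eta> where "\<eta> = \<epsilon> / (4 * (real L + 1))"
  have "0 < \<eta>" using assms by (simp add: \<eta>_def add_nonneg_pos)
  then obtain d where d: "1 \<le> d" "\<forall>J. finite J \<and> J \<subseteq> {d<..} \<longrightarrow> (\<Sum>i\<in>J. p i) \<le> \<eta>"
    using small_tail by blast
  have "measure_pmf.prob (edge_pmf n p) {X. long_edge d (near_ends L n) X} \<le> \<epsilon>" for n
  proof -
    have "measure_pmf.prob (edge_pmf n p) {X. long_edge d (near_ends L n) X} \<le> 2 * real (card (near_ends L n)) * \<eta>"
      by (rule prob_long_edge[OF _ card_near_ends(1)]) (use d(2) in blast)
    also have "\<dots> \<le> 4 * (real L + 1) * \<eta>"
    proof (rule mult_right_mono)
      have "real (card (near_ends L n)) \<le> real (2 * L)" using card_near_ends(2) by (simp only: of_nat_le_iff)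
      then show "2 * real (card (near_ends L n)) \<le> 4 * (real L + 1)" by simp
    qed (use \<open>0 < \<eta>\<close> in simp)
    also have "\<dots> = \<epsilon>" by (simp add: \<eta>_def field_simps add_nonneg_eq_0_iff)
    finally show ?thesis .
  qed
  then show ?thesis using d(1) by blast
qed

text \<open>
  Each step from a bounded number of vertices is short with high probability; the bound \<open>L\<close> does not
  depend on \<open>n\<close>.
\<close>

lemma nbhd_stays_near_ends:
  assumes "0 < \<epsilon>"
  shows "\<exists>L\<ge>1. \<forall>n\<ge>1. measure_pmf.prob (edge_pmf n p) {X. \<not> nbhd (pair_graph n X) r {1, n} \<subseteq> near_ends L n} \<le> \<epsilon>"
  using assms
proof (induction r arbitrary: \<epsilon>)
  case 0
  have "measure_pmf.prob (edge_pmf n p) {X. \<not> nbhd (pair_graph n X) 0 {1, n} \<subseteq> near_ends 1 n} \<le> \<epsilon>" if "1 \<le> n" for n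
  proof -
    have "{1, n} \<subseteq> near_ends 1 n" using that by (auto simp: near_ends_def)
    then show ?thesis using 0 by simp
  qed
  then show ?case by blast
next
  case (Suc r)
  then have "0 < \<epsilon> / 2" by simp
  then obtain L where L: "1 \<le> L"
    "\<And>n. 1 \<le> n \<Longrightarrow> measure_pmf.prob (edge_pmf n p) {X. \<not> nbhd (pair_graph n X) r {1, n} \<subseteq> near_ends L n} \<le> \<epsilon> / 2"
    using Suc.IH by blast
  obtain d where d: "1 \<le> d"
    "\<And>n. measure_pmf.prob (edge_pmf n p) {X. long_edge d (near_ends L n) X} \<le> \<epsilon> / 2"
    using small_prob_long_edge_near_ends[OF \<open>0 < \<epsilon> / 2\<close>] by blast
  have "measure_pmf.prob (edge_pmf n p) {X. \<not> nbhd (pair_graph n X) (Suc r) {1, n} \<subseteq> near_ends (L + d) n} \<le> \<epsilon>"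
    if n: "1 \<le> n" for n
  proof -
    let ?P = "measure_pmf.prob (edge_pmf n p)"
    have "nbhd (pair_graph n X) (Suc r) {1, n} \<subseteq> near_ends (L + d) n"
      if nb: "nbhd (pair_graph n X) r {1, n} \<subseteq> near_ends L n" and short: "\<not> long_edge d (near_ends L n) X" for X
    proof -
      have "y \<in> near_ends (L + d) n" if x: "x \<in> near_ends L n" and l: "linked (pair_graph n X) x y" for x y
      proof -
        have "\<not> x + d < y \<and> \<not> y + d < x" if "joined X x y"
          using short x that unfolding long_edge_def by blast
        then have "y \<le> x + d" "x \<le> y + d" using l d(1) by (auto simp: linked_def joined_def)
        moreover have "1 \<le> y" "y \<le> n" using l by (auto simp: linked_def)
        ultimately show ?thesis using x by (auto simp: near_ends_def)
      qed
      moreover have "near_ends L n \<subseteq> near_ends (L + d) n" by (auto simp: near_ends_def)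
      ultimately show ?thesis using nb by auto
    qed
    then have "?P {X. \<not> nbhd (pair_graph n X) (Suc r) {1, n} \<subseteq> near_ends (L + d) n}
        \<le> ?P ({X. \<not> nbhd (pair_graph n X) r {1, n} \<subseteq> near_ends L n} \<union> {X. long_edge d (near_ends L n) X})"
      by (intro prob_mono_support) blast
    also have "\<dots> \<le> \<epsilon> / 2 + \<epsilon> / 2"
      using prob_Un_le L(2)[OF n] d(2) by (rule order_trans[OF _ add_mono])
    finally show ?thesis by simp
  qed
  then show ?case using L(1) by (intro exI[of _ "L + d"]) simp
qed

text \<open>
  Outside an event of probability \<open>\<epsilon>\<close>, the truth value of \<open>\<psi>\<close> is a function of the restriction to
  the ends that does not depend on \<open>n\<close>, and by \<open>ends_restriction_law\<close> the distribution of this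
  restriction does not depend on \<open>n\<close> either. So \<open>\<gamma>\<close> is the probability that this function, the
  indicator of \<open>G\<close>, is true.
\<close>

lemma Prob_eventually_near_constant:
  assumes \<psi>: "sentence \<psi>" and \<epsilon>: "0 < \<epsilon>"
  shows "\<exists>\<gamma> N. \<forall>n\<ge>N. \<bar>Prob n p \<psi> - \<gamma>\<bar> \<le> \<epsilon>"
proof -
  define Q where "Q = qrank \<psi>"
  have \<epsilon>3: "0 < \<epsilon> / 3" using \<epsilon> by simp
  obtain L where L: "1 \<le> L"
    "\<And>n. 1 \<le> n \<Longrightarrow> measure_pmf.prob (edge_pmf n p) {X. \<not> nbhd (pair_graph n X) (2^Q) {1, n} \<subseteq> near_ends L n} \<le> \<epsilon> / 3"
    using nbhd_stays_near_ends[OF \<epsilon>3] by blast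
  obtain d where d: "\<And>n. measure_pmf.prob (edge_pmf n p) {X. long_edge d (near_ends L n) X} \<le> \<epsilon> / 3"
    using small_prob_long_edge_near_ends[OF \<epsilon>3] by blast
  obtain N0 where N0: "\<And>n. N0 \<le> n \<Longrightarrow> measure_pmf.prob (edge_pmf n p) {X. \<not> plentiful Q (Suc Q) n X} \<le> \<epsilon> / 3"
    using whp_plentiful \<epsilon>3 unfolding whp_def by metis
  define N where "N = max N0 (2 * L + d + 2)"
  define good where "good = (\<lambda>n X. nbhd (pair_graph n X) (2^Q) {1, n} \<subseteq> near_ends L n \<and>
     \<not> long_edge d (near_ends L n) X \<and> plentiful Q (Suc Q) n X)"
  have bad: "measure_pmf.prob (edge_pmf n p) {X. \<not> good n X} \<le> \<epsilon>" if n: "N \<le> n" for n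
  proof -
    let ?P = "measure_pmf.prob (edge_pmf n p)"
    let ?A = "{X. \<not> nbhd (pair_graph n X) (2^Q) {1, n} \<subseteq> near_ends L n}"
    let ?B = "{X. long_edge d (near_ends L n) X}" and ?C = "{X. \<not> plentiful Q (Suc Q) n X}"
    have "{X. \<not> good n X} = ?A \<union> (?B \<union> ?C)" by (auto simp: good_def)
    then have "?P {X. \<not> good n X} \<le> ?P ?A + ?P (?B \<union> ?C)" by (simp only: prob_Un_le)
    moreover have "?P (?B \<union> ?C) \<le> ?P ?B + ?P ?C" by (rule prob_Un_le)
    moreover have "?P ?A \<le> \<epsilon> / 3" "?P ?B \<le> \<epsilon> / 3" "?P ?C \<le> \<epsilon> / 3"
      using L(2)[of n] d[of n] N0[of n] n by (simp_all add: N_def)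
    ultimately show ?thesis by linarith
  qed
  have agree: "holds (pair_graph n X) \<psi> \<longleftrightarrow> holds (pair_graph m Y) \<psi>"
    if X: "X \<in> set_pmf (edge_pmf n p)" "good n X" "N \<le> n" and Y: "Y \<in> set_pmf (edge_pmf m p)" "good m Y" "N \<le> m"
      and eq: "ends_restriction L n X = ends_restriction L m Y" for n m X Y
  proof (rule loc_eq_holds[OF _ _ \<psi>])
    show "rich Q (Suc Q) (pair_graph n X) (pair_graph m Y)" "rich Q (Suc Q) (pair_graph m Y) (pair_graph n X)"
      using X(1,2) Y(1,2) by (auto simp: good_def plentiful_def)
    show "loc_eq Q (pair_graph n X) (pair_graph m Y)
        {(first_elem (pair_graph n X), first_elem (pair_graph m Y)), (last_elem (pair_graph n X), last_elem (pair_graph m Y))}"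
      unfolding pair_graph_simps
      by (rule ends_loc_eq[OF X(1) Y(1), where L = L and d = d])
         (use X(2,3) Y(2,3) L(1) eq in \<open>auto simp: good_def N_def\<close>)
  qed (use X(3) Y(3) in \<open>auto simp: Q_def N_def\<close>)
  define D where "D = Pi_pmf (UNIV \<times> vertex_pairs L) False (\<lambda>(b :: bool, v, w). bernoulli_pmf (p (w - v)))"
  define G where "G = {H. \<exists>n\<ge>N. \<exists>X\<in>set_pmf (edge_pmf n p). good n X \<and> ends_restriction L n X = H \<and> holds (pair_graph n X) \<psi>}"
  have "\<bar>Prob n p \<psi> - measure_pmf.prob D G\<bar> \<le> \<epsilon>" if n: "N \<le> n" for n
  proof -
    let ?P = "measure_pmf.prob (edge_pmf n p)"
    let ?H = "{X. holds (pair_graph n X) \<psi>}" and ?R = "{X. ends_restriction L n X \<in> G}"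
    have iff: "X \<in> ?H \<longleftrightarrow> X \<in> ?R" if X: "X \<in> set_pmf (edge_pmf n p)" "good n X" for X
    proof
      show "X \<in> ?R" if "X \<in> ?H" using X n that unfolding G_def by blast
      show "X \<in> ?H" if R: "X \<in> ?R"
      proof -
        obtain m Y where "N \<le> m" "Y \<in> set_pmf (edge_pmf m p)" "good m Y"
          "ends_restriction L m Y = ends_restriction L n X" "holds (pair_graph m Y) \<psi>"
          using R unfolding G_def by auto
        then show ?thesis using agree[of Y m X n] X n by simp
      qed
    qed
    have "measure_pmf.prob D G = ?P ?R"
      using n unfolding D_def N_def by (subst ends_restriction_law[of L n p, symmetric]) (simp_all add: vimage_def)
    moreover have "?P ?H \<le> ?P (?R \<union> {X. \<not> good n X})" "?P ?R \<le> ?P (?H \<union> {X. \<not> good n X})"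
      by (rule prob_mono_support; use iff in auto)+
    moreover have "?P (?R \<union> {X. \<not> good n X}) \<le> ?P ?R + \<epsilon>" "?P (?H \<union> {X. \<not> good n X}) \<le> ?P ?H + \<epsilon>"
      using prob_Un_le[of "edge_pmf n p" ?R "{X. \<not> good n X}"] prob_Un_le[of "edge_pmf n p" ?H "{X. \<not> good n X}"] bad[OF n]
      by linarith+
    ultimately show ?thesis unfolding Prob_eq_edge_pmf by linarith
  qed
  then show ?thesis by blast
qed

lemma convergent_Prob:
  assumes "sentence \<psi>"
  shows "convergent (\<lambda>n. Prob n p \<psi>)"
proof -
  have "Cauchy (\<lambda>n. Prob n p \<psi>)"
  proof (rule metric_CauchyI)
    fix e :: real assume "0 < e"
    then have "0 < e / 3" by simp
    then obtain \<gamma> N where N: "\<And>n. N \<le> n \<Longrightarrow> \<bar>Prob n p \<psi> - \<gamma>\<bar> \<le> e / 3"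
      using Prob_eventually_near_constant[OF assms] by blast
    have "dist (Prob m p \<psi>) (Prob n p \<psi>) < e" if "N \<le> m" "N \<le> n" for m n
      using N[OF that(1)] N[OF that(2)] \<open>0 < e\<close> unfolding dist_real_def by linarith
    then show "\<exists>N. \<forall>m\<ge>N. \<forall>n\<ge>N. dist (Prob m p \<psi>) (Prob n p \<psi>) < e" by blast
  qed
  then show ?thesis by (simp add: Cauchy_convergent_iff)
qed

end

section \<open>The convergence law\<close>

lemma convergent_Prob_of_positive_product:
  assumes p: "\<forall>i\<ge>1. 0 \<le> p i \<and> p i < 1" and P: "0 < P" "(\<lambda>i. 1 - p (Suc i)) has_prod P"
    and "sentence \<psi>"
  shows "convergent (\<lambda>n. Prob n p \<psi>)"
proof -
  have lim: "(\<lambda>n. \<Prod>i\<le>n. 1 - p (Suc i)) \<longlonglongrightarrow> P"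
    using P by (simp add: has_prod_imp_tendsto)
  have shift: "(\<Prod>i=1..n. 1 - p i) = (\<Prod>i<n. 1 - p (Suc i))" for n
    by (induction n) (simp_all add: prod.lessThan_Suc mult.commute)
  have dec: "decseq (\<lambda>n. \<Prod>i\<le>n. 1 - p (Suc i))"
  proof (rule decseq_SucI)
    fix n
    have "0 \<le> (\<Prod>i\<le>n. 1 - p (Suc i))" by (rule prod_nonneg) (use p in \<open>auto intro: less_imp_le\<close>)
    moreover have "1 - p (Suc (Suc n)) \<le> 1" using p by simp
    ultimately have "(\<Prod>i\<le>n. 1 - p (Suc i)) * (1 - p (Suc (Suc n))) \<le> (\<Prod>i\<le>n. 1 - p (Suc i)) * 1"
      by (intro mult_left_mono) auto
    then show "(\<Prod>i\<le>Suc n. 1 - p (Suc i)) \<le> (\<Prod>i\<le>n. 1 - p (Suc i))" by simp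
  qed
  have "P \<le> (\<Prod>i=1..n. 1 - p i)" for n
  proof -
    have "P \<le> (\<Prod>i\<le>n. 1 - p (Suc i))" by (rule decseq_ge[OF dec lim])
    also have "\<dots> = (\<Prod>i<n. 1 - p (Suc i)) * (1 - p (Suc n))" by (simp add: lessThan_Suc_atMost[symmetric])
    also have "\<dots> \<le> (\<Prod>i<n. 1 - p (Suc i)) * 1"
      by (intro mult_left_mono prod_nonneg) (use p in \<open>auto intro: less_imp_le\<close>)
    finally show ?thesis unfolding shift by simp
  qed
  then interpret edge_probabilities p P
    by unfold_locales (use p P in auto)
  show ?thesis using assms(4) by (rule convergent_Prob)
qed

section \<open>An oscillating sequence\<close>

lemma Prob_first_adj_last:
  assumes "\<And>i. 1 \<le> i \<Longrightarrow> 0 \<le> p i \<and> p i \<le> 1" "2 \<le> n"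
  shows "Prob n p (Adj Const_first Const_last) = p (n - 1)"
proof -
  have e: "(1, n) \<in> vertex_pairs n" using assms(2) by (simp add: vertex_pairs_def)
  have "Prob n p (Adj Const_first Const_last) = measure_pmf.prob (edge_pmf n p) {X. joined X 1 n}"
    using assms(2) by (simp add: Prob_eq_edge_pmf holds_sentence[of _ 1] sentence_def)
  also have "\<dots> = measure_pmf.prob (edge_pmf n p) {X. X (1, n)}"
    using joined_support(1)[of _ n p 1 n] assms(2)
    by (intro antisym prob_mono_support) auto
  also have "\<dots> = p (n - 1)"
    using prob_Pi_pmf_cylinder[OF finite_vertex_pairs, of "{(1, n)}" n False "\<lambda>(v, w). bernoulli_pmf (p (w - v))" "\<lambda>_. True"]
      e assms(1)[of "n - 1"] assms(2) unfolding edge_pmf_def by simp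
  finally show ?thesis .
qed

text \<open>
  The sentence says that the first and the last vertex are adjacent, which has probability
  \<open>p (n - 1)\<close>. The sequence \<open>p\<close> vanishes except at very sparse places \<open>a k\<close>, where it equals
  \<open>1 - 1 / (k + 2)\<close>. The product up to \<open>n\<close> is thus at least \<open>c k\<close> until \<open>a (Suc k)\<close> is reached, and the
  places are sparse enough for \<open>\<omega>\<close> to exceed \<open>k / c k\<close> from \<open>a k\<close> on.
\<close>

lemma oscillating_example:
  assumes \<omega>: "filterlim \<omega> at_top sequentially"
  shows "\<exists>(p :: nat \<Rightarrow> real) \<psi>.
               (\<forall>i\<ge>1. 0 \<le> p i \<and> p i \<le> 1) \<and>
               sentence \<psi> \<and>
               filterlim (\<lambda>n. \<omega> n * (\<Prod>i=1..n. 1 - p i)) at_top sequentially \<and>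
               liminf (\<lambda>n. ereal (Prob n p \<psi>)) = 0 \<and>
               limsup (\<lambda>n. ereal (Prob n p \<psi>)) = 1"
proof -
  define c where "c = (\<lambda>k. \<Prod>j\<le>k. 1 / (real j + 2))"
  have c_pos: "0 < c k" for k by (auto simp: c_def intro: prod_pos)
  have "\<forall>k. \<exists>N. \<forall>n\<ge>N. real k / c k \<le> \<omega> n"
    using \<omega> unfolding filterlim_at_top eventually_sequentially by blast
  then obtain N where N: "\<And>k n. N k \<le> n \<Longrightarrow> real k / c k \<le> \<omega> n" by metis
  \<comment> \<open>Gaps of at least two make \<open>p\<close> vanish at \<open>a k + 1\<close>.\<close>
  define a where "a = rec_nat (N 0 + 1) (\<lambda>k x. max (x + 2) (N (Suc k)))"
  have a0: "a 0 = N 0 + 1" and aS: "a (Suc k) = max (a k + 2) (N (Suc k))" for k by (simp_all add: a_def)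
  have aN: "N k \<le> a k" for k by (cases k) (simp_all add: a0 aS)
  have step: "a k + 2 \<le> a (Suc k)" for k by (simp add: aS)
  have "a k < a (Suc k)" for k using step[of k] by simp
  then have mono: "strict_mono a" by (simp add: strict_mono_Suc_iff)
  have a1: "1 \<le> a k" for k using strict_mono_less_eq[OF mono, of 0 k] by (simp add: a0)
  define p :: "nat \<Rightarrow> real" where "p = (\<lambda>i. if i \<in> range a then 1 - 1 / (real (inv a i) + 2) else 0)"
  have inj: "inj a" using mono by (rule strict_mono_imp_inj_on)
  have pa: "p (a k) = 1 - 1 / (real k + 2)" for k using inj by (simp add: p_def)
  have p0: "p i = 0" if "i \<notin> range a" for i using that by (simp add: p_def)
  have p01: "0 \<le> p i \<and> p i \<le> 1" for i by (simp add: p_def)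
  have gap: "a k + 1 \<notin> range a" for k
  proof
    assume "a k + 1 \<in> range a"
    then obtain j where j: "a j = a k + 1" by auto
    then have "k < j" using strict_mono_less[OF mono, of k j] by simp
    then have "a (Suc k) \<le> a j" using strict_mono_less_eq[OF mono, of "Suc k" j] by simp
    then show False using step[of k] j by simp
  qed
  have prod: "c k \<le> (\<Prod>i=1..n. 1 - p i)" if "n < a (Suc k)" for n k
  proof -
    let ?J = "{1..n} \<inter> range a"
    have "(\<Prod>i=1..n. 1 - p i) = (\<Prod>i\<in>?J. 1 - p i)"
      by (rule prod.mono_neutral_right) (auto simp: p0)
    moreover have "?J \<subseteq> a ` {..k}"
    proof
      fix i assume "i \<in> ?J"
      then obtain j where j: "i = a j" "a j \<le> n" by auto
      then have "j < Suc k" using that strict_mono_less[OF mono, of j "Suc k"] by simp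
      then show "i \<in> a ` {..k}" using j by auto
    qed
    moreover have "(\<Prod>i\<in>a ` {..k}. 1 - p i) \<le> (\<Prod>i\<in>?J. 1 - p i)"
    proof -
      have "(\<Prod>i\<in>a ` {..k}. 1 - p i) = (\<Prod>i\<in>?J. 1 - p i) * (\<Prod>i\<in>a ` {..k} - ?J. 1 - p i)"
        using prod.subset_diff[OF \<open>?J \<subseteq> a ` {..k}\<close>, of "\<lambda>i. 1 - p i"] by (simp add: mult.commute)
      also have "\<dots> \<le> (\<Prod>i\<in>?J. 1 - p i) * 1"
        by (intro mult_left_mono prod_le_1 prod_nonneg) (use p01 in \<open>auto simp: le_diff_eq\<close>)
      finally show ?thesis by simp
    qed
    moreover have "(\<Prod>i\<in>a ` {..k}. 1 - p i) = c k"
      using prod.reindex[OF inj_on_subset[OF inj subset_UNIV[of "{..k}"]], of "\<lambda>i. 1 - p i"] by (simp add: c_def pa)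
    ultimately show ?thesis by linarith
  qed
  have big: "real k \<le> \<omega> n * (\<Prod>i=1..n. 1 - p i)" if n: "a k \<le> n" for n k
  proof -
    have "\<exists>j. n < a (Suc j)" using strict_mono_imp_increasing[OF mono, of "Suc n"] by (intro exI[of _ n]) simp
    define j where "j = (LEAST j. n < a (Suc j))"
    have j: "n < a (Suc j)" unfolding j_def by (rule LeastI_ex) fact
    have aj: "a j \<le> n"
    proof (cases j)
      case 0
      then show ?thesis using n strict_mono_less_eq[OF mono, of 0 k] by simp
    next
      case (Suc i)
      then have "\<not> n < a (Suc i)" using not_less_Least[of i "\<lambda>j. n < a (Suc j)"] by (simp add: j_def)
      then show ?thesis using Suc by simp
    qed
    have "k \<le> j"
    proof -
      have "a k < a (Suc j)" using n j by simp
      then show ?thesis using strict_mono_less[OF mono, of k "Suc j"] by simp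
    qed
    have "real j / c j \<le> \<omega> n" by (rule N) (use aj aN[of j] in simp)
    then have "real j \<le> \<omega> n * c j" using c_pos[of j] by (simp add: pos_divide_le_eq)
    moreover have "0 \<le> \<omega> n"
      using \<open>real j / c j \<le> \<omega> n\<close> c_pos[of j] by (meson divide_nonneg_pos of_nat_0_le_iff order_trans)
    ultimately have "real j \<le> \<omega> n * (\<Prod>i=1..n. 1 - p i)"
      using mult_left_mono[OF prod[OF j], of "\<omega> n"] by simp
    then show ?thesis using \<open>k \<le> j\<close> by simp
  qed
  have lim: "filterlim (\<lambda>n. \<omega> n * (\<Prod>i=1..n. 1 - p i)) at_top sequentially"
    unfolding filterlim_at_top eventually_sequentially
  proof
    fix Z :: real
    obtain k where "Z \<le> real k" using real_arch_simple by blast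
    then show "\<exists>N. \<forall>n\<ge>N. Z \<le> \<omega> n * (\<Prod>i=1..n. 1 - p i)"
      using big[of k] by (meson order_trans)
  qed
  define \<psi> where "\<psi> = Adj Const_first Const_last"
  define f where "f = (\<lambda>n. ereal (Prob n p \<psi>))"
  have f: "f (Suc n) = ereal (p n)" if "1 \<le> n" for n
    using Prob_first_adj_last[of p "Suc n"] p01 that by (simp add: f_def \<psi>_def)
  have f01: "0 \<le> f n" "f n \<le> 1" for n by (simp_all add: f_def Prob_def)
  have low: "(f \<circ> (\<lambda>k. a k + 2)) \<longlonglongrightarrow> 0"
  proof -
    have "f (a k + 2) = 0" for k using f[of "a k + 1"] p0[OF gap[of k]] by simp
    then show ?thesis by (simp add: comp_def)
  qed
  have high: "(f \<circ> (\<lambda>k. a k + 1)) \<longlonglongrightarrow> 1"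
  proof -
    have "(\<lambda>k. 1 / (real k + 2)) \<longlonglongrightarrow> 0"
      using LIMSEQ_ignore_initial_segment[OF lim_1_over_n[where 'a = real], of 2] by (simp add: add.commute)
    from tendsto_diff[OF tendsto_const this, of 1]
    have "(\<lambda>k. 1 - 1 / (real k + 2)) \<longlonglongrightarrow> 1" by simp
    then have "(\<lambda>k. ereal (1 - 1 / (real k + 2))) \<longlonglongrightarrow> ereal 1" by simp
    moreover have "f \<circ> (\<lambda>k. a k + 1) = (\<lambda>k. ereal (1 - 1 / (real k + 2)))"
      using f[OF a1] by (simp add: comp_def pa fun_eq_iff)
    ultimately show ?thesis by (simp add: one_ereal_def)
  qed
  have sub: "strict_mono (\<lambda>k. a k + 2)" "strict_mono (\<lambda>k. a k + 1)"
    using mono by (simp_all add: strict_mono_def)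
  have "liminf f \<le> 0"
    using liminf_subseq_mono[OF sub(1), of f] lim_imp_Liminf[OF _ low] by simp
  moreover have "0 \<le> liminf f" by (rule Liminf_bounded) (simp add: f01)
  moreover have "1 \<le> limsup f"
    using limsup_subseq_mono[OF sub(2), of f] lim_imp_Limsup[OF _ high] by simp
  moreover have "limsup f \<le> 1" by (rule Limsup_bounded) (simp add: f01)
  ultimately have "liminf f = 0" "limsup f = 1" by auto
  moreover have "sentence \<psi>" by (simp add: \<psi>_def sentence_def)
  ultimately show ?thesis using p01 lim unfolding f_def by blast
qed

theorem theorem2:
  shows "(\<forall>p :: nat \<Rightarrow> real.
            (\<forall>i\<ge>1. 0 \<le> p i \<and> p i < 1) \<longrightarrow>
            (\<exists>P>0. (\<lambda>i. 1 - p (Suc i)) has_prod P) \<longrightarrow>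
            (\<forall>\<psi>. sentence \<psi> \<longrightarrow> convergent (\<lambda>n. Prob n p \<psi>)))
       \<and> (\<forall>\<omega> :: nat \<Rightarrow> real.
            filterlim \<omega> at_top sequentially \<longrightarrow>
            (\<exists>(p :: nat \<Rightarrow> real) \<psi>.
               (\<forall>i\<ge>1. 0 \<le> p i \<and> p i \<le> 1) \<and>
               sentence \<psi> \<and>
               filterlim (\<lambda>n. \<omega> n * (\<Prod>i=1..n. 1 - p i)) at_top sequentially \<and>
               liminf (\<lambda>n. ereal (Prob n p \<psi>)) = 0 \<and>
               limsup (\<lambda>n. ereal (Prob n p \<psi>)) = 1))"
  using convergent_Prob_of_positive_product oscillating_example by blast

end
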